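(* Let $r\in\{3,5,7\}$ and let $q\in\mathbb{C}$ be a primitive $r$-th root of unity. Let $H^i$ be the noncommutative de Rham cohomology of the 4-dimensional differential calculus on the reduced quantum group $\mathcal{A}=\mathbb{C}_q[SL_2]$, and let $\theta=e_a+e_d$ (which satisfies $\mathrm{d}\theta=0$ and $\theta\wedge\theta=0$). Then the sequence $$0\to H^0\to H^1\to H^2\to H^3\to H^4\to0,$$ whose maps $H^i\to H^{i+1}$ are induced by $\omega\mapsto\theta\wedge\omega$, is exact.
   Context: Put $\mu=1-q^{-2}$. $\mathcal{A}$ is the unital $\mathbb{C}$-algebra generated by $a,b,c,d$ with relations $ba=qab$, $ca=qac$, $db=qbd$, $dc=qcd$, $cb=bc$, $da-ad=q\mu bc$, $ad-q^{-1}bc=1$, $a^r=d^r=1$, $b^r=c^r=0$. It has basis $\{a^mb^nc^k\}_{0\le m,n,k\le r-1}$. $\Lambda$ is the graded algebra generated by degree-1 elements $e_a,e_b,e_c,e_d$ with relations: $e_b,e_c,e_d$ pairwise anticommute and square to zero; $e_a\wedge e_a=\mu e_b\wedge e_c$; $e_a\wedge e_d+e_d\wedge e_a+\mu e_b\wedge e_c=0$; $e_a\wedge e_b+q^2e_b\wedge e_a-\mu e_b\wedge e_d=0$; $e_c\wedge e_a+q^2e_a\wedge e_c+\mu e_c\wedge e_d=0$. It has dimensions $1,4,6,4,1$ in degrees $0,\dots,4$. The exterior algebra $\Omega=\Lambda\otimes\mathcal{A}$ is the free right $\mathcal{A}$-module on $\Lambda$, with algebra structure given by those of $\Lambda$,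 $\mathcal{A}$ and the following cross relations, where $(u,v)$ is either $(a,c)$ or $(b,d)$: $ve_b=e_bv$, $ue_c=e_cu$, $ue_d=q^{-1}e_du$, $ve_d=qe_dv$, $ue_b=e_bu+q\mu e_dv$, $ve_c=e_cv+q\mu e_du$, $ve_a=q^{-1}e_av+\mu e_bu$, $ue_a=qe_au+\mu e_cv+q\mu^2e_du$. The exterior derivative is $\mathrm{d}\omega=-(\theta\wedge\omega-(-1)^{|\omega|}\omega\wedge\theta)$ with $\theta=e_a+e_d$; it satisfies $\mathrm{d}^2=0$ and the graded Leibniz rule. $H^i$ is the degree-$i$ cohomology of $(\Omega,\mathrm{d})$. *)

theory Defs
  imports Complex_Main "HOL-Library.Poly_Mapping" "HOL-Algebra.Exact_Sequence"
    "HOL-Algebra.Algebraic_Closure_Type"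
begin

definition primitive_root_of_unity :: "nat \<Rightarrow> complex \<Rightarrow> bool" where
  "primitive_root_of_unity r q \<longleftrightarrow> r > 0 \<and> q ^ r = 1 \<and> (\<forall>k. 0 < k \<and> k < r \<longrightarrow> q ^ k \<noteq> 1)"


section \<open>Free algebras\<close>

datatype 'x word = Word (letters: "'x list")

text \<open>Words form the free monoid, written additively with concatenation as \<open>+\<close>, because the
  convolution product on \<^typ>\<open>'x word \<Rightarrow>\<^sub>0 complex\<close> is indexed by an additive
  monoid. Hence it is the free unital complex algebra on the elements of \<^typ>\<open>'x\<close>.\<close>

instantiation word :: (type) monoid_add
begin

definition zero_word :: "'x word" where "zero_word = Word []"

definition plus_word :: "'x word \<Rightarrow> 'x word \<Rightarrow> 'x word" where
  "plus_word v w = Word (letters v @ letters w)"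

instance by standard (simp_all add: zero_word_def plus_word_def)

end

type_synonym 'x free_algebra = "'x word \<Rightarrow>\<^sub>0 complex"

definition gen :: "'x \<Rightarrow> 'x free_algebra" where
  "gen x = Poly_Mapping.single (Word [x]) 1"

definition scalar :: "complex \<Rightarrow> 'x free_algebra" where
  "scalar z = Poly_Mapping.single 0 z"


section \<open>The exterior algebra of reduced quantum SL2\<close>

datatype generator = Ga | Gb | Gc | Gd | Gea | Geb | Gec | Ged

abbreviation "xa \<equiv> gen Ga"
abbreviation "xb \<equiv> gen Gb"
abbreviation "xc \<equiv> gen Gc"
abbreviation "xd \<equiv> gen Gd"
abbreviation "ea \<equiv> gen Gea"
abbreviation "eb \<equiv> gen Geb"
abbreviation "ec \<equiv> gen Gec"
abbreviation "ed \<equiv> gen Ged"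

definition mu :: "complex \<Rightarrow> complex" where
  "mu q = 1 - 1 / q\<^sup>2"

text \<open>A relation \<open>s = t\<close> is recorded as the element \<open>s - t\<close>.\<close>

definition function_rels :: "complex \<Rightarrow> nat \<Rightarrow> generator free_algebra set" where
  "function_rels q r =
    {xb * xa - scalar q * xa * xb,
     xc * xa - scalar q * xa * xc,
     xd * xb - scalar q * xb * xd,
     xd * xc - scalar q * xc * xd,
     xc * xb - xb * xc,
     xd * xa - xa * xd - scalar (q * mu q) * xb * xc,
     xa * xd - scalar (inverse q) * xb * xc - 1,
     xa ^ r - 1, xd ^ r - 1, xb ^ r, xc ^ r}"

definition form_rels :: "complex \<Rightarrow> generator free_algebra set" where
  "form_rels q =
    {eb * eb, ec * ec, ed * ed,
     eb * ec + ec * eb, eb * ed + ed * eb, ec * ed + ed * ec,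
     ea * ea - scalar (mu q) * eb * ec,
     ea * ed + ed * ea + scalar (mu q) * eb * ec,
     ea * eb + scalar (q\<^sup>2) * eb * ea - scalar (mu q) * eb * ed,
     ec * ea + scalar (q\<^sup>2) * ea * ec + scalar (mu q) * ec * ed}"

definition cross_rels :: "complex \<Rightarrow> generator free_algebra set" where
  "cross_rels q = (\<Union>(u, v) \<in> {(xa, xc), (xb, xd)}.
    {v * eb - eb * v,
     u * ec - ec * u,
     u * ed - scalar (inverse q) * ed * u,
     v * ed - scalar q * ed * v,
     u * eb - (eb * u + scalar (q * mu q) * ed * v),
     v * ec - (ec * v + scalar (q * mu q) * ed * u),
     v * ea - (scalar (inverse q) * ea * v + scalar (mu q) * eb * u),
     u * ea - (scalar q * ea * u + scalar (mu q) * ec * v + scalar (q * (mu q)\<^sup>2) * ed * u)})"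

definition Omega_ideal :: "complex \<Rightarrow> nat \<Rightarrow> generator free_algebra set" where
  "Omega_ideal q r = genideal ring_of_type_algebra
     (function_rels q r \<union> form_rels q \<union> cross_rels q)"

text \<open>The product \<open>\<Lambda> \<otimes> \<A>\<close> with its cross relations, as the algebra generated by \<open>\<Lambda>\<close> and \<open>\<A>\<close>
  subject to them: the cross relations move every form to the left of every function, so that
  multiplication \<open>\<Lambda> \<otimes> \<A> \<rightarrow> \<Omega>\<close> is onto, and they are compatible with the relations of the two
  factors, so that it is bijective.\<close>

definition Omega :: "complex \<Rightarrow> nat \<Rightarrow> generator free_algebra set ring" where
  "Omega q r = ring_of_type_algebra Quot Omega_ideal q r"

definition Omega_class :: "complex \<Rightarrow> nat \<Rightarrow> generator free_algebra \<Rightarrow> generator free_algebra set"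
  where "Omega_class q r x = Omega_ideal q r +>\<^bsub>ring_of_type_algebra\<^esub> x"

definition form_degree :: "generator word \<Rightarrow> nat" where
  "form_degree w = length (filter (\<lambda>g. g \<in> {Gea, Geb, Gec, Ged}) (letters w))"

definition forms :: "complex \<Rightarrow> nat \<Rightarrow> nat \<Rightarrow> generator free_algebra set set" where
  "forms q r i =
     Omega_class q r ` {x. \<forall>w \<in> Poly_Mapping.keys x. form_degree w = i}"

definition theta :: "complex \<Rightarrow> nat \<Rightarrow> generator free_algebra set" where
  "theta q r = Omega_class q r (ea + ed)"

text \<open>\<open>ext_d q r i\<close> is the exterior derivative on forms of degree \<open>i\<close>.\<close>

definition ext_d ::
  "complex \<Rightarrow> nat \<Rightarrow> nat \<Rightarrow> generator free_algebra set \<Rightarrow> generator free_algebra set" where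
  "ext_d q r i \<omega> =
     (let R = Omega q r; \<theta> = theta q r in
      \<ominus>\<^bsub>R\<^esub> ((\<theta> \<otimes>\<^bsub>R\<^esub> \<omega>) \<ominus>\<^bsub>R\<^esub> ((\<ominus>\<^bsub>R\<^esub> \<one>\<^bsub>R\<^esub>) [^]\<^bsub>R\<^esub> i) \<otimes>\<^bsub>R\<^esub> (\<omega> \<otimes>\<^bsub>R\<^esub> \<theta>)))"


section \<open>Cohomology\<close>

definition cocycle_group ::
  "complex \<Rightarrow> nat \<Rightarrow> nat \<Rightarrow> generator free_algebra set monoid" where
  "cocycle_group q r i =
     (add_monoid (Omega q r))
       \<lparr>carrier := {\<omega> \<in> forms q r i. ext_d q r i \<omega> = \<zero>\<^bsub>Omega q r\<^esub>}\<rparr>"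

definition coboundaries :: "complex \<Rightarrow> nat \<Rightarrow> nat \<Rightarrow> generator free_algebra set set" where
  "coboundaries q r i =
     (case i of 0 \<Rightarrow> {\<zero>\<^bsub>Omega q r\<^esub>} | Suc j \<Rightarrow> ext_d q r j ` forms q r j)"

definition cohomology ::
  "complex \<Rightarrow> nat \<Rightarrow> nat \<Rightarrow> generator free_algebra set set monoid" where
  "cohomology q r i = cocycle_group q r i Mod coboundaries q r i"

text \<open>The map \<open>H\<^sup>i \<rightarrow> H\<^sup>i\<^sup>+\<^sup>1\<close>, \<open>[\<omega>] \<mapsto> [\<theta> \<and> \<omega>]\<close>; the image below is a singleton because
  \<open>\<theta> \<and> d \<alpha> = - d (\<theta> \<and> \<alpha>)\<close> (as \<open>d \<theta> = 0\<close>).\<close>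

definition theta_map ::
  "complex \<Rightarrow> nat \<Rightarrow> nat \<Rightarrow> generator free_algebra set set \<Rightarrow> generator free_algebra set set" where
  "theta_map q r i C =
     the_elem ((\<lambda>\<omega>. coboundaries q r (Suc i) #>\<^bsub>cocycle_group q r (Suc i)\<^esub>
                       (theta q r \<otimes>\<^bsub>Omega q r\<^esub> \<omega>)) ` C)"

end

theory Submission
  imports Defs
begin

text \<open>There is a skew derivation \<open>\<partial>\<close> of \<open>\<Omega>\<close> of degree \<open>-1\<close> that sends \<open>e\<^sub>a\<close> to \<open>1\<close> and kills all other
  generators, twisted by an automorphism \<open>\<sigma>\<close> rescaling the generators. It satisfies
  \<open>\<partial> (\<theta> \<omega>) + \<theta> \<partial> \<omega> = \<omega>\<close> and \<open>\<partial> \<^bold>d + \<^bold>d \<partial> = \<Sigma> - 1\<close> for the exterior derivative \<open>\<^bold>d\<close>, where \<open>\<Sigma>\<close> is the automorphism that multiplies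
  \<open>a, b\<close> by \<open>q\<close>, \<open>c, d\<close> by \<open>q\<^sup>-\<^sup>1\<close>, \<open>e\<^sub>b\<close> by \<open>q\<^sup>-\<^sup>2\<close> and \<open>e\<^sub>c\<close> by \<open>q\<^sup>2\<close> and fixes \<open>e\<^sub>a, e\<^sub>d\<close>. Since \<open>\<Sigma>\<^sup>r = 1\<close>,
  averaging over the powers of \<open>\<Sigma>\<close> projects onto the \<open>\<Sigma>\<close>-invariant forms without changing cohomology,
  and on invariant forms \<open>\<partial>\<close> anticommutes with \<open>\<^bold>d\<close>. Hence \<open>\<partial>\<close> induces on cohomology a contracting
  homotopy for left multiplication by \<open>\<theta>\<close>. At the right end one also needs that forms of degree five vanish.\<close>

section \<open>Free algebras\<close>

lemma letters_plus [simp]: "letters (v + w) = letters v @ letters w"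
  by (simp add: plus_word_def)

lemma letters_zero [simp]: "letters 0 = []"
  by (simp add: zero_word_def)

lemma free_algebra_eq_sum_single:
  "x = (\<Sum>w\<in>Poly_Mapping.keys x. Poly_Mapping.single w (Poly_Mapping.lookup x w))"
proof (rule poly_mapping_eqI)
  fix v
  have "(\<Sum>w\<in>Poly_Mapping.keys x. Poly_Mapping.lookup x w when w = v) = Poly_Mapping.lookup x v"
    by (cases "v \<in> Poly_Mapping.keys x")
      (auto simp: when_def sum.delta not_in_keys_iff_lookup_eq_zero)
  then show "Poly_Mapping.lookup x v = Poly_Mapping.lookup
      (\<Sum>w\<in>Poly_Mapping.keys x. Poly_Mapping.single w (Poly_Mapping.lookup x w)) v"
    by (simp add: lookup_sum lookup_single)
qed

lemma scalar_simps [simp]: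
  "scalar 0 = 0" "scalar 1 = 1"
  "scalar (y + z) = scalar y + scalar z" "scalar (- z) = - scalar z"
  "scalar (y - z) = scalar y - scalar z"
  by (simp_all add: scalar_def single_add single_uminus single_diff)

lemma scalar_mult: "scalar (y * z) = scalar y * scalar z"
  by (simp add: scalar_def mult_single)

lemma scalar_mult_scalar: "scalar y * (scalar z * x) = scalar (y * z) * x"
  by (simp add: scalar_mult mult.assoc)

text \<open>Words span the free algebra, so a property stable under \<open>scalar z * x + y\<close>
  only has to be checked on single words.\<close>

lemma free_algebra_induct [case_names single add]:
  assumes "\<And>w. P (Poly_Mapping.single w 1)"
    and "\<And>x y z. P x \<Longrightarrow> P y \<Longrightarrow> P (scalar z * x + y)"
  shows "P (x :: 'x free_algebra)"
proof -
  \<comment> \<open>Zero is obtained as \<open>- 1 + 1\<close>, with \<open>1\<close> the empty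
    word.\<close>
  have zero: "P 0"
    using assms(2)[OF assms(1)[of 0] assms(1)[of 0], of "- 1"] by simp
  have "P (\<Sum>w\<in>A. Poly_Mapping.single w (Poly_Mapping.lookup x w))" if "finite A" for A
    using that
  proof (induction A)
    case (insert w A)
    have "scalar c * Poly_Mapping.single w 1 = Poly_Mapping.single w c" for c
      by (simp add: scalar_def mult_single)
    then show ?case
      using assms(2)[OF assms(1)[of w] insert.IH, where z = "Poly_Mapping.lookup x w"] insert.hyps by simp
  qed (use zero in simp)
  then show ?thesis
    by (subst free_algebra_eq_sum_single) simp
qed

lemma scalar_central: "x * scalar z = scalar z * x"
proof (induction x rule: free_algebra_induct)
  case (add x y c)
  have "scalar c * x * scalar z = scalar z * (scalar c * x)"
    by (simp add: add mult.assoc scalar_mult_scalar mult.commute[of c])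
  with add show ?case
    by (simp add: algebra_simps)
qed (simp add: scalar_def mult_single)

lemma scalar_left_commute: "x * (scalar z * y) = scalar z * (x * y)"
  by (metis mult.assoc scalar_central)

section \<open>Linear maps, rescalings and skew derivations of the free algebra\<close>

definition linear_ext :: "('x word \<Rightarrow> 'x free_algebra) \<Rightarrow> 'x free_algebra \<Rightarrow> 'x free_algebra" where
  "linear_ext f x = (\<Sum>w\<in>Poly_Mapping.keys x. scalar (Poly_Mapping.lookup x w) * f w)"

lemma linear_ext_single [simp]: "linear_ext f (Poly_Mapping.single w z) = scalar z * f w"
  by (simp add: linear_ext_def)

lemma linear_ext_add [simp]: "linear_ext f (x + y) = linear_ext f x + linear_ext f y"
  unfolding linear_ext_def
  by (rule setsum_keys_plus_distrib) (simp_all add: algebra_simps)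

lemma linear_ext_zero [simp]: "linear_ext f 0 = 0"
  by (simp add: linear_ext_def)

lemma linear_ext_minus [simp]: "linear_ext f (- x) = - linear_ext f x"
  using linear_ext_add[of f x "- x"] by (simp add: eq_neg_iff_add_eq_0 add.commute)

lemma linear_ext_diff [simp]: "linear_ext f (x - y) = linear_ext f x - linear_ext f y"
  using linear_ext_add[of f x "- y"] by simp

lemma linear_ext_sum [simp]: "linear_ext f (\<Sum>i\<in>A. g i) = (\<Sum>i\<in>A. linear_ext f (g i))"
  by (induction A rule: infinite_finite_induct) simp_all

lemma linear_ext_scalar_mult [simp]: "linear_ext f (scalar z * x) = scalar z * linear_ext f x"
proof -
  have *: "linear_ext f (\<Sum>w\<in>A. scalar z * Poly_Mapping.single w (c w))
      = scalar z * linear_ext f (\<Sum>w\<in>A. Poly_Mapping.single w (c w))" for A c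
    unfolding linear_ext_sum sum_distrib_left
    by (intro sum.cong refl) (simp add: scalar_def mult_single flip: mult.assoc)
  show ?thesis
    using *[of "Poly_Mapping.lookup x" "Poly_Mapping.keys x"]
    by (simp only: flip: sum_distrib_left free_algebra_eq_sum_single)
qed

text \<open>This is the algebra endomorphism determined by \<open>gen g\<close> going to
  \<open>scalar (\<chi> g) * gen g\<close>; words are eigenvectors of it.\<close>

definition rescale :: "('x \<Rightarrow> complex) \<Rightarrow> 'x free_algebra \<Rightarrow> 'x free_algebra" where
  "rescale \<chi> = linear_ext (\<lambda>w. Poly_Mapping.single w (prod_list (map \<chi> (letters w))))"

text \<open>The recursion splits off the first letter by the twisted Leibniz rule \<open>\<partial>
  (x * y) = \<partial> x * y + \<sigma> x * \<partial> y\<close>, where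
  \<open>\<sigma> = rescale \<chi>\<close>. Such an operator is determined by its values on
  generators, here 1 at \<open>g\<close> and 0 at all others.\<close>

primrec skew_deriv_list :: "('x \<Rightarrow> complex) \<Rightarrow> 'x \<Rightarrow> 'x list \<Rightarrow> 'x free_algebra" where
  "skew_deriv_list \<chi> g [] = 0"
| "skew_deriv_list \<chi> g (x # xs) =
     (if x = g then Poly_Mapping.single (Word xs) 1 else 0) + scalar (\<chi> x) * gen x * skew_deriv_list \<chi> g xs"

definition skew_deriv :: "('x \<Rightarrow> complex) \<Rightarrow> 'x \<Rightarrow> 'x free_algebra \<Rightarrow> 'x free_algebra" where
  "skew_deriv \<chi> g = linear_ext (\<lambda>w. skew_deriv_list \<chi> g (letters w))"

lemma rescale_linear [simp]:
  "rescale \<chi> (x + y) = rescale \<chi> x + rescale \<chi> y" "rescale \<chi> 0 = 0"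
  "rescale \<chi> (- x) = - rescale \<chi> x" "rescale \<chi> (x - y) = rescale \<chi> x - rescale \<chi> y"
  "rescale \<chi> (scalar z * x) = scalar z * rescale \<chi> x"
  "rescale \<chi> (\<Sum>i\<in>A. h i) = (\<Sum>i\<in>A. rescale \<chi> (h i))"
  by (simp_all add: rescale_def)

lemma skew_deriv_linear [simp]:
  "skew_deriv \<chi> g (x + y) = skew_deriv \<chi> g x + skew_deriv \<chi> g y" "skew_deriv \<chi> g 0 = 0"
  "skew_deriv \<chi> g (- x) = - skew_deriv \<chi> g x"
  "skew_deriv \<chi> g (x - y) = skew_deriv \<chi> g x - skew_deriv \<chi> g y"
  "skew_deriv \<chi> g (scalar z * x) = scalar z * skew_deriv \<chi> g x"
  "skew_deriv \<chi> g (\<Sum>i\<in>A. h i) = (\<Sum>i\<in>A. skew_deriv \<chi> g (h i))"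
  by (simp_all add: skew_deriv_def)

lemma rescale_single [simp]:
  "rescale \<chi> (Poly_Mapping.single w z) = scalar (prod_list (map \<chi> (letters w))) * Poly_Mapping.single w z"
  by (simp add: rescale_def scalar_def mult_single mult.commute)

lemma skew_deriv_single [simp]:
  "skew_deriv \<chi> g (Poly_Mapping.single w z) = scalar z * skew_deriv_list \<chi> g (letters w)"
  by (simp add: skew_deriv_def)

lemma single_scalar_mult [simp]:
  "Poly_Mapping.single w c * (scalar z * x) = scalar z * (Poly_Mapping.single w c * x)"
  "gen g * (scalar z * x) = scalar z * (gen g * x)"
  by (rule scalar_left_commute)+

lemma rescale_mult [simp]: "rescale \<chi> (x * y) = rescale \<chi> x * rescale \<chi> y"
proof (induction x rule: free_algebra_induct)
  case (single v)
  show ?case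
  proof (induction y rule: free_algebra_induct)
    case (single w)
    show ?case
      by (simp add: mult.assoc scalar_mult_scalar) (simp add: mult_single)
  next
    case (add x y z)
    then show ?case
      by (simp add: distrib_left scalar_left_commute[of "rescale \<chi> (Poly_Mapping.single v 1)"]
          del: rescale_single)
  qed
qed (simp add: algebra_simps)

lemma rescale_one [simp]: "rescale \<chi> 1 = 1"
  using rescale_single[of \<chi> 0 1] by simp

lemma rescale_gen [simp]: "rescale \<chi> (gen x) = scalar (\<chi> x) * gen x"
  by (simp add: gen_def)

lemma rescale_scalar [simp]: "rescale \<chi> (scalar z) = scalar z"
  using rescale_linear(5)[of \<chi> z 1] by simp

lemma rescale_power [simp]: "rescale \<chi> (x ^ n) = rescale \<chi> x ^ n"
  by (induction n) simp_all

text \<open>Passing a prefix collects one factor \<open>\<chi> x\<close> per letter, and these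
  together are the effect of \<open>rescale \<chi>\<close> on the prefix.\<close>

lemma skew_deriv_list_append:
  "skew_deriv_list \<chi> g (xs @ ys) = skew_deriv_list \<chi> g xs * Poly_Mapping.single (Word ys) 1
     + rescale \<chi> (Poly_Mapping.single (Word xs) 1) * skew_deriv_list \<chi> g ys"
proof (induction xs)
  case Nil
  show ?case
    by (simp flip: zero_word_def)
next
  case (Cons x xs)
  have *: "Poly_Mapping.single (Word (x # zs)) (1::complex)
      = gen x * Poly_Mapping.single (Word zs) 1" for zs
    by (simp add: gen_def mult_single plus_word_def)
  have "Poly_Mapping.single (Word (xs @ ys)) (1::complex)
      = Poly_Mapping.single (Word xs) 1 * Poly_Mapping.single (Word ys) 1"
    by (simp add: mult_single plus_word_def)
  with Cons show ?case
    by (simp add: distrib_left distrib_right mult.assoc * scalar_mult_scalar)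
qed

lemma skew_deriv_mult:
  "skew_deriv \<chi> g (x * y) = skew_deriv \<chi> g x * y + rescale \<chi> x * skew_deriv \<chi> g y"
proof (induction x rule: free_algebra_induct)
  case (single v)
  show ?case
  proof (induction y rule: free_algebra_induct)
    case (single w)
    show ?case
      by (cases v; cases w) (simp add: mult_single plus_word_def skew_deriv_list_append)
  next
    case (add x y z)
    then show ?case
      by (simp add: distrib_left scalar_left_commute[of "rescale \<chi> (Poly_Mapping.single v 1)"]
          scalar_left_commute[of "skew_deriv \<chi> g (Poly_Mapping.single v 1)"]
          del: rescale_single skew_deriv_single)
  qed
qed (simp add: algebra_simps)

lemma skew_deriv_gen [simp]: "skew_deriv \<chi> g (gen x) = (if x = g then 1 else 0)"
  by (simp add: gen_def flip: zero_word_def)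

lemma skew_deriv_one [simp]: "skew_deriv \<chi> g 1 = 0"
  using skew_deriv_single[of \<chi> g 0 1] by simp

lemma skew_deriv_scalar [simp]: "skew_deriv \<chi> g (scalar z) = 0"
  using skew_deriv_linear(5)[of \<chi> g z 1] by simp

lemma skew_deriv_power: "skew_deriv \<chi> g x = 0 \<Longrightarrow> skew_deriv \<chi> g (x ^ n) = 0"
  by (induction n) (simp_all add: skew_deriv_mult)

lemma rescale_rescale: "rescale \<chi> (rescale \<psi> x) = rescale (\<lambda>g. \<chi> g * \<psi> g) x"
proof (induction x rule: free_algebra_induct)
  case (single w)
  have "prod_list (map \<psi> xs) * prod_list (map \<chi> xs) = prod_list (map (\<lambda>g. \<chi> g * \<psi> g) xs)" for xs
    by (induction xs) simp_all
  then show ?case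
    by (simp add: scalar_mult_scalar)
qed simp

lemma rescale_id [simp]: "rescale (\<lambda>_. 1) x = x"
  by (induction x rule: free_algebra_induct) (simp_all add: map_replicate_const)

lemma scalar_power: "scalar z ^ n = scalar (z ^ n)"
  by (induction n) (simp_all add: scalar_mult)

lemma scalar_mult_power: "(scalar z * x) ^ n = scalar (z ^ n) * x ^ n"
  by (induction n) (simp_all add: mult.assoc scalar_left_commute[of "x ^ _"] scalar_left_commute[of x] scalar_mult_scalar)

section \<open>The defining ideal\<close>

lemma ring_type_algebra_ring: "ring (ring_of_type_algebra :: 'b::ring_1 ring)"
proof -
  have "\<exists>y. x + y = 0" for x :: 'b
    by (rule exI[of _ "- x"]) simp
  then show ?thesis
    by unfold_locales
      (auto simp: ring_of_type_algebra_def algebra_simps Units_def add_eq_0_iff add_eq_0_iff2)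
qed

text \<open>The generated ideal is the least one containing \<open>R\<close>. This reduces stability
  of \<open>Omega_ideal\<close> under an operator to a check on the defining relations.\<close>

lemma genideal_type_algebra_subset:
  fixes R S :: "'b::ring_1 set"
  assumes "R \<subseteq> S" "0 \<in> S" "\<And>x y. x \<in> S \<Longrightarrow> y \<in> S \<Longrightarrow> x - y \<in> S"
    and "\<And>x y. x \<in> S \<Longrightarrow> y * x \<in> S" "\<And>x y. x \<in> S \<Longrightarrow> x * y \<in> S"
  shows "genideal ring_of_type_algebra R \<subseteq> S"
proof -
  interpret A: ring "ring_of_type_algebra :: 'b ring"
    by (rule ring_type_algebra_ring)
  have minus: "- x \<in> S" if "x \<in> S" for x
    using assms(3)[OF assms(2) that] by simp
  have plus: "x + y \<in> S" if "x \<in> S" "y \<in> S" for x y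
    using assms(3)[OF that(1) minus[OF that(2)]] by simp
  have inv: "\<ominus>\<^bsub>ring_of_type_algebra\<^esub> x = - x" for x :: 'b
    by (rule A.minus_equality) (simp_all add: ring_of_type_algebra_def)
  have "ideal S (ring_of_type_algebra :: 'b ring)"
  proof (rule idealI)
    show "subgroup S (add_monoid (ring_of_type_algebra :: 'b ring))"
      by (rule A.add.subgroupI, unfold inv) 
        (use assms minus plus in \<open>auto simp: ring_of_type_algebra_def\<close>)
  qed (use assms A.ring_axioms in \<open>auto simp: ring_of_type_algebra_def\<close>)
  then show ?thesis
    using A.genideal_minimal assms(1) by blast
qed

lemma Omega_ideal_is_ideal: "ideal (Omega_ideal q r) ring_of_type_algebra"
  unfolding Omega_ideal_def
  by (rule ring.genideal_ideal[OF ring_type_algebra_ring]) (simp add: ring_of_type_algebra_def)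

lemma Omega_ideal_rels:
  "x \<in> function_rels q r \<union> form_rels q \<union> cross_rels q \<Longrightarrow> x \<in> Omega_ideal q r"
  using ring.genideal_self[OF ring_type_algebra_ring,
      of "function_rels q r \<union> form_rels q \<union> cross_rels q"]
  unfolding Omega_ideal_def by (auto simp: ring_of_type_algebra_def)

lemma Omega_ideal_mult:
  assumes "x \<in> Omega_ideal q r"
  shows "y * x \<in> Omega_ideal q r" "x * y \<in> Omega_ideal q r"
  using ideal.I_l_closed[OF Omega_ideal_is_ideal assms, where x = y]
    ideal.I_r_closed[OF Omega_ideal_is_ideal assms, where x = y]
  by (simp_all add: ring_of_type_algebra_def)

lemma Omega_ideal_zero: "0 \<in> Omega_ideal q r"
  using additive_subgroup.zero_closed[OF ideal.axioms(1)[OF Omega_ideal_is_ideal]]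
  by (simp add: ring_of_type_algebra_def)

lemma Omega_ideal_add: "x \<in> Omega_ideal q r \<Longrightarrow> y \<in> Omega_ideal q r \<Longrightarrow> x + y \<in> Omega_ideal q r"
  using additive_subgroup.a_closed[OF ideal.axioms(1)[OF Omega_ideal_is_ideal], where x = x and y = y]
  by (simp add: ring_of_type_algebra_def)

lemma Omega_ideal_minus: "x \<in> Omega_ideal q r \<Longrightarrow> - x \<in> Omega_ideal q r"
  using Omega_ideal_mult(1)[where x = x and y = "- 1"] by simp

lemma Omega_ideal_diff: "x \<in> Omega_ideal q r \<Longrightarrow> y \<in> Omega_ideal q r \<Longrightarrow> x - y \<in> Omega_ideal q r"
  by (metis Omega_ideal_add Omega_ideal_minus diff_conv_add_uminus)

lemma Omega_ideal_sum: "(\<And>i. i \<in> A \<Longrightarrow> f i \<in> Omega_ideal q r) \<Longrightarrow> (\<Sum>i\<in>A. f i) \<in> Omega_ideal q r"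
  by (induction A rule: infinite_finite_induct) (simp_all add: Omega_ideal_zero Omega_ideal_add)

lemma Omega_ideal_cross:
  assumes "(u, v) \<in> {(xa, xc), (xb, xd)}"
  shows "v * eb - eb * v \<in> Omega_ideal q r"
    "u * ec - ec * u \<in> Omega_ideal q r"
    "u * ed - scalar (inverse q) * ed * u \<in> Omega_ideal q r"
    "v * ed - scalar q * ed * v \<in> Omega_ideal q r"
    "u * eb - (eb * u + scalar (q * mu q) * ed * v) \<in> Omega_ideal q r"
    "v * ec - (ec * v + scalar (q * mu q) * ed * u) \<in> Omega_ideal q r"
    "v * ea - (scalar (inverse q) * ea * v + scalar (mu q) * eb * u) \<in> Omega_ideal q r"
    "u * ea - (scalar q * ea * u + scalar (mu q) * ec * v + scalar (q * (mu q)\<^sup>2) * ed * u)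
      \<in> Omega_ideal q r"
  by (rule Omega_ideal_rels, unfold cross_rels_def, use assms in blast)+

lemma Omega_ideal_form:
  "eb * eb \<in> Omega_ideal q r" "ec * ec \<in> Omega_ideal q r" "ed * ed \<in> Omega_ideal q r"
  "eb * ec + ec * eb \<in> Omega_ideal q r" "eb * ed + ed * eb \<in> Omega_ideal q r"
  "ec * ed + ed * ec \<in> Omega_ideal q r"
  "ea * ea - scalar (mu q) * eb * ec \<in> Omega_ideal q r"
  "ea * ed + ed * ea + scalar (mu q) * eb * ec \<in> Omega_ideal q r"
  "ea * eb + scalar (q\<^sup>2) * eb * ea - scalar (mu q) * eb * ed \<in> Omega_ideal q r"
  "ec * ea + scalar (q\<^sup>2) * ea * ec + scalar (mu q) * ec * ed \<in> Omega_ideal q r"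
  by (rule Omega_ideal_rels, unfold form_rels_def, blast)+

section \<open>Rescaling automorphisms and the contraction\<close>

text \<open>All defining relations are homogeneous for these weights as soon as \<open>t ^ r = 1\<close>.\<close>

fun weight :: "complex \<Rightarrow> complex \<Rightarrow> generator \<Rightarrow> complex" where
  "weight t s Ga = t" | "weight t s Gb = t" | "weight t s Gc = 1 / t" | "weight t s Gd = 1 / t"
| "weight t s Gea = s" | "weight t s Ged = s" | "weight t s Geb = s / t\<^sup>2" | "weight t s Gec = s * t\<^sup>2"

text \<open>The parameter \<open>s\<close> measures form degree: \<open>twist 1 (- 1)\<close> is the
  sign of the grading, \<open>twist q 1\<close> is the automorphism \<Sigma> and
  \<open>twist q (- 1)\<close> is the automorphism \<sigma> that twists the contraction.\<close>

abbreviation twist :: "complex \<Rightarrow> complex \<Rightarrow> generator free_algebra \<Rightarrow> generator free_algebra" where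
  "twist t s \<equiv> rescale (weight t s)"

abbreviation contr :: "complex \<Rightarrow> generator free_algebra \<Rightarrow> generator free_algebra" where
  "contr q \<equiv> skew_deriv (weight q (- 1)) Gea"

text \<open>A relation that is an eigenvector is sent to a multiple of itself, hence stays in the
  ideal; the eigenvalue is an explicit argument so that it can be computed factor by factor.\<close>

definition eigenvector :: "('x \<Rightarrow> complex) \<Rightarrow> complex \<Rightarrow> 'x free_algebra \<Rightarrow> bool" where
  "eigenvector \<chi> c x \<longleftrightarrow> rescale \<chi> x = scalar c * x"

text \<open>In the rules for sums the equality of eigenvalues is a separate premise, because the
  eigenvalues computed for the two summands may agree only after simplification.\<close>

lemma eigenvector_intros:
  "eigenvector \<chi> (\<chi> g) (gen g)"
  "eigenvector \<chi> 1 1"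
  "eigenvector \<chi> 1 (scalar z)"
  "eigenvector \<chi> c x \<Longrightarrow> eigenvector \<chi> c' y \<Longrightarrow> c' = c \<Longrightarrow> eigenvector \<chi> c (x + y)"
  "eigenvector \<chi> c x \<Longrightarrow> eigenvector \<chi> c' y \<Longrightarrow> c' = c \<Longrightarrow> eigenvector \<chi> c (x - y)"
  "eigenvector \<chi> c x \<Longrightarrow> eigenvector \<chi> c' y \<Longrightarrow> eigenvector \<chi> (c * c') (x * y)"
  "eigenvector \<chi> c x \<Longrightarrow> eigenvector \<chi> (c ^ n) (x ^ n)"
  by (simp_all add: eigenvector_def algebra_simps scalar_mult scalar_mult_power
      scalar_left_commute[of x])

text \<open>The condition \<open>t ^ r = 1\<close> is what makes \<open>xa ^ r - 1\<close> and
  \<open>xd ^ r - 1\<close> homogeneous. Each relation has constant form degree, so \<open>s\<close>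
  is arbitrary.\<close>

lemma rels_eigenvector:
  assumes "t \<noteq> 0" "t ^ r = 1" "x \<in> function_rels q r \<union> form_rels q \<union> cross_rels q"
  shows "\<exists>c. eigenvector (weight t s) c x"
proof -
  have "\<forall>x\<in>function_rels q r \<union> form_rels q \<union> cross_rels q. \<exists>c. eigenvector (weight t s) c x"
    unfolding function_rels_def form_rels_def cross_rels_def UN_insert UN_empty case_prod_conv
      ball_Un ball_simps
    by (intro conjI TrueI)
      (rule exI, (rule eigenvector_intros |
        (use assms in \<open>simp add: field_simps power2_eq_square\<close>; fail))+)+
  with assms show ?thesis by blast
qed

lemma twist_Omega_ideal:
  assumes "t \<noteq> 0" "t ^ r = 1" "x \<in> Omega_ideal q r"
  shows "twist t s x \<in> Omega_ideal q r"
proof -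
  have "Omega_ideal q r \<subseteq> {x. twist t s x \<in> Omega_ideal q r}"
    unfolding Omega_ideal_def
  proof (rule genideal_type_algebra_subset, unfold mem_Collect_eq rescale_mult rescale_linear
      Omega_ideal_def[symmetric])
    show "function_rels q r \<union> form_rels q \<union> cross_rels q \<subseteq> {x. twist t s x \<in> Omega_ideal q r}"
      using rels_eigenvector[OF assms(1,2)] Omega_ideal_rels Omega_ideal_mult
      unfolding eigenvector_def by (metis (no_types, lifting) mem_Collect_eq subsetI)
  qed (auto intro: Omega_ideal_zero Omega_ideal_diff Omega_ideal_mult)
  with assms show ?thesis by auto
qed

text \<open>The weights of \<sigma> are chosen for this: in every relation containing
  \<open>ea\<close>, the terms left after removing \<open>ea\<close> cancel already in the free
  algebra. For example \<open>ea * ea\<close> gives \<open>ea - ea\<close>, and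
  \<open>ea * eb + scalar (q\<^sup>2) * eb * ea\<close> gives \<open>eb - eb\<close> because
  \<sigma> multiplies \<open>eb\<close> by \<open>- 1 / q\<^sup>2\<close>.\<close>

lemma contr_rels:
  assumes "q \<noteq> 0" "x \<in> function_rels q r \<union> form_rels q \<union> cross_rels q"
  shows "contr q x = 0"
proof -
  have "\<forall>x\<in>function_rels q r \<union> form_rels q \<union> cross_rels q. contr q x = 0"
    using assms
    unfolding function_rels_def form_rels_def cross_rels_def UN_insert UN_empty case_prod_conv
      ball_Un ball_simps
    by (simp add: skew_deriv_mult skew_deriv_power mult.assoc scalar_mult_scalar inverse_eq_divide flip: scalar_mult)
  with assms show ?thesis by blast
qed

lemma contr_Omega_ideal:
  assumes "q \<noteq> 0" "q ^ r = 1" "x \<in> Omega_ideal q r"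
  shows "contr q x \<in> Omega_ideal q r"
proof -
  \<comment> \<open>By the twisted Leibniz rule the contraction of \<open>x * y\<close> contains
    \<sigma>(x) times the contraction of \<open>y\<close>, and that of \<open>y * x\<close> contains
    \<open>x\<close> itself. Hence all three memberships have to be carried along together.\<close>
  let ?S = "{x \<in> Omega_ideal q r. twist q (- 1) x \<in> Omega_ideal q r \<and> contr q x \<in> Omega_ideal q r}"
  have "Omega_ideal q r \<subseteq> ?S"
    unfolding Omega_ideal_def
  proof (rule genideal_type_algebra_subset, unfold mem_Collect_eq rescale_mult rescale_linear
      skew_deriv_mult skew_deriv_linear Omega_ideal_def[symmetric])
    show "function_rels q r \<union> form_rels q \<union> cross_rels q \<subseteq> ?S"
    proof (intro subsetI CollectI)
      fix x assume x: "x \<in> function_rels q r \<union> form_rels q \<union> cross_rels q"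
      show "x \<in> Omega_ideal q r \<and> twist q (- 1) x \<in> Omega_ideal q r \<and> contr q x \<in> Omega_ideal q r"
        using Omega_ideal_rels[OF x] twist_Omega_ideal[OF assms(1,2)] contr_rels[OF assms(1) x]
        by (simp add: Omega_ideal_zero)
    qed
  qed (auto intro: Omega_ideal_zero Omega_ideal_diff Omega_ideal_add Omega_ideal_mult)
  with assms show ?thesis by auto
qed

section \<open>Vanishing of forms of degree five\<close>

text \<open>For a filtration \<open>F\<close>, \<open>filt_step e F\<close> is \<open>F + e F[-1]\<close>. Adjoining \<open>e\<^sub>d\<close>, \<open>e\<^sub>b\<close>, \<open>e\<^sub>c\<close>, \<open>e\<^sub>a\<close> in this
  order keeps the filtration stable under left multiplication: moving a generator past the new
  \<open>e\<close> only produces corrections among those already adjoined.\<close>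

definition filt_step :: "'b::ring_1 \<Rightarrow> (nat \<Rightarrow> 'b set) \<Rightarrow> nat \<Rightarrow> 'b set" where
  "filt_step e F n =
     (case n of 0 \<Rightarrow> F 0 | Suc m \<Rightarrow> {z. \<exists>x\<in>F (Suc m). \<exists>y\<in>F m. z = x + e * y})"

definition raises :: "(nat \<Rightarrow> 'b::ring_1 set) \<Rightarrow> nat \<Rightarrow> 'b \<Rightarrow> bool" where
  "raises F k z \<longleftrightarrow> (\<forall>n. \<forall>x\<in>F n. z * x \<in> F (n + k))"

text \<open>Every level contains the ideal \<open>J\<close>, so identities modulo \<open>J\<close>
  suffice for proving membership.\<close>

locale filtration =
  fixes J :: "'b::ring_1 set" and F :: "nat \<Rightarrow> 'b set"
  assumes zero: "0 \<in> J"
    and right_ideal: "x \<in> J \<Longrightarrow> x * y \<in> J"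
    and subset: "J \<subseteq> F n"
    and add: "x \<in> F n \<Longrightarrow> y \<in> F n \<Longrightarrow> x + y \<in> F n"
begin

lemma raises_zero: "raises F k 0"
  using zero subset by (auto simp: raises_def)

lemma raises_add: "raises F k z \<Longrightarrow> raises F k w \<Longrightarrow> raises F k (z + w)"
  by (auto simp: raises_def distrib_right intro: add)

lemma raises_mult: "raises F k z \<Longrightarrow> raises F l w \<Longrightarrow> m = k + l \<Longrightarrow> raises F m (z * w)"
  unfolding raises_def mult.assoc by (metis add.assoc add.commute)

lemma filt_step_upper: "x \<in> F n \<Longrightarrow> x \<in> filt_step e F n"
  using zero subset by (cases n) (force simp: filt_step_def)+

lemma filtration_filt_step: "filtration J (filt_step e F)"
proof
  show "x + y \<in> filt_step e F n" if "x \<in> filt_step e F n" "y \<in> filt_step e F n" for x y n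
  proof (cases n)
    case 0
    with that show ?thesis by (simp add: filt_step_def add)
  next
    case (Suc m)
    with that obtain x1 x2 y1 y2 where "x = x1 + e * x2" "y = y1 + e * y2"
      "x1 \<in> F n" "y1 \<in> F n" "x2 \<in> F m" "y2 \<in> F m"
      by (auto simp: filt_step_def)
    then have "x + y = (x1 + y1) + e * (x2 + y2)" "x1 + y1 \<in> F n" "x2 + y2 \<in> F m"
      by (simp_all add: algebra_simps add)
    with Suc show ?thesis by (auto simp: filt_step_def)
  qed
qed (use zero right_ideal subset filt_step_upper in \<open>blast+\<close>)

text \<open>Moving \<open>z\<close> past \<open>e\<close> gives \<open>e * s\<close> plus a
  correction \<open>t\<close>. The correction has lost the factor \<open>e\<close>, so it must raise
  the degree by one more than \<open>z\<close> does.\<close>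

lemma raises_filt_step:
  assumes "z * e - (e * s + t) \<in> J" "raises F k z" "raises F k s" "raises F (Suc k) t"
  shows "raises (filt_step e F) k z"
  unfolding raises_def
proof (intro allI ballI)
  fix n x assume x: "x \<in> filt_step e F n"
  show "z * x \<in> filt_step e F (n + k)"
  proof (cases n)
    case 0
    with x have "x \<in> F 0"
      by (simp add: filt_step_def)
    with assms(2) have "z * x \<in> F (0 + k)"
      unfolding raises_def by blast
    with 0 show ?thesis
      by (intro filt_step_upper) simp
  next
    case (Suc m)
    with x obtain x1 x2 where x12: "x = x1 + e * x2" "x1 \<in> F n" "x2 \<in> F m"
      by (auto simp: filt_step_def)
    have "z * x = (z * x1 + t * x2 + (z * e - (e * s + t)) * x2) + e * (s * x2)"
      unfolding x12 by (simp add: algebra_simps)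
    moreover have "z * x1 \<in> F (n + k)" "t * x2 \<in> F (n + k)" "s * x2 \<in> F (m + k)"
      using assms(2-4) x12 Suc unfolding raises_def by force+
    moreover have "(z * e - (e * s + t)) * x2 \<in> F (n + k)"
      using right_ideal[OF assms(1)] subset by auto
    ultimately show ?thesis
      using Suc by (auto simp: filt_step_def intro: add)
  qed
qed

text \<open>A product with two factors \<open>e\<close> is reduced by replacing \<open>e * e\<close>
  by \<open>t\<close>, an expression of degree two in what was adjoined before.\<close>

lemma raises_filt_step_self:
  assumes "e * e - t \<in> J" "raises F (Suc (Suc 0)) t"
  shows "raises (filt_step e F) (Suc 0) e"
  unfolding raises_def
proof (intro allI ballI)
  fix n x assume x: "x \<in> filt_step e F n"
  show "e * x \<in> filt_step e F (n + Suc 0)"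
  proof (cases n)
    case 0
    have "e * x = 0 + e * x" by simp
    with 0 x zero subset show ?thesis
      by (force simp: filt_step_def)
  next
    case (Suc m)
    with x obtain x1 x2 where x12: "x = x1 + e * x2" "x1 \<in> F n" "x2 \<in> F m"
      by (auto simp: filt_step_def)
    have "e * x = (t * x2 + (e * e - t) * x2) + e * x1"
      unfolding x12 by (simp add: algebra_simps)
    moreover have "t * x2 \<in> F (Suc n)"
      using assms(2) x12 Suc unfolding raises_def by force
    moreover have "(e * e - t) * x2 \<in> F (Suc n)"
      using right_ideal[OF assms(1)] subset by auto
    ultimately show ?thesis
      using x12 by (auto simp: filt_step_def intro: add)
  qed
qed

end

text \<open>Adjoining one generator raises the top nonzero degree modulo \<open>J\<close> by at most
  one.\<close>

lemma filt_step_eq_ideal: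
  assumes "filtration J F" "\<And>n. n > k \<Longrightarrow> F n \<subseteq> J" "\<And>x. x \<in> J \<Longrightarrow> e * x \<in> J"
    "\<And>x y. x \<in> J \<Longrightarrow> y \<in> J \<Longrightarrow> x + y \<in> J" "n > Suc k"
  shows "filt_step e F n \<subseteq> J"
proof (cases n)
  case (Suc m)
  with assms(5) have "F n \<subseteq> J" "F m \<subseteq> J" using assms(2) by auto
  with Suc assms(3,4) show ?thesis by (auto simp: filt_step_def subset_iff)
qed (use assms in simp)

section \<open>The grading by form degree\<close>

definition homogeneous :: "nat \<Rightarrow> generator free_algebra \<Rightarrow> bool" where
  "homogeneous n x \<longleftrightarrow> (\<forall>w\<in>Poly_Mapping.keys x. form_degree w = n)"

lemma homogeneous_induct [consumes 1, case_names zero single add]: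
  assumes "homogeneous n x"
    and "P 0" "\<And>w. form_degree w = n \<Longrightarrow> P (Poly_Mapping.single w 1)"
    and "\<And>x y z. P x \<Longrightarrow> P y \<Longrightarrow> P (scalar z * x + y)"
  shows "P x"
proof -
  have "P (\<Sum>w\<in>A. scalar (Poly_Mapping.lookup x w) * Poly_Mapping.single w 1)"
    if "finite A" "A \<subseteq> Poly_Mapping.keys x" for A
    using that
  proof (induction A)
    case empty
    then show ?case using assms(2) by simp
  next
    case (insert w A)
    then have "P (Poly_Mapping.single w 1)"
      using assms(1,3) by (simp add: homogeneous_def)
    with insert show ?case
      by (simp add: assms(4))
  qed
  from this[of "Poly_Mapping.keys x"] show ?thesis
    by (subst free_algebra_eq_sum_single) (simp add: scalar_def mult_single)
qed

lemma homogeneous_zero [simp]: "homogeneous n 0"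
  by (simp add: homogeneous_def)

lemma homogeneous_add: "homogeneous n x \<Longrightarrow> homogeneous n y \<Longrightarrow> homogeneous n (x + y)"
  using keys_add[of x y] unfolding homogeneous_def by blast

lemma homogeneous_mult:
  assumes "homogeneous m x" "homogeneous n y"
  shows "homogeneous (m + n) (x * y)"
  unfolding homogeneous_def
proof
  fix w assume "w \<in> Poly_Mapping.keys (x * y)"
  then obtain u v where "w = u + v" "u \<in> Poly_Mapping.keys x" "v \<in> Poly_Mapping.keys y"
    using keys_mult[of x y] by blast
  with assms show "form_degree w = m + n"
    by (simp add: homogeneous_def form_degree_def)
qed

lemma homogeneous_scalar_mult:
  assumes "homogeneous n x"
  shows "homogeneous n (scalar z * x)"
proof -
  have "homogeneous 0 (scalar z)"
    by (simp add: homogeneous_def scalar_def form_degree_def)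
  from homogeneous_mult[OF this assms] show ?thesis by simp
qed

lemma homogeneous_minus: "homogeneous n x \<Longrightarrow> homogeneous n (- x)"
  using homogeneous_scalar_mult[where z = "- 1"] by simp

lemma homogeneous_diff: "homogeneous n x \<Longrightarrow> homogeneous n y \<Longrightarrow> homogeneous n (x - y)"
  unfolding diff_conv_add_uminus by (intro homogeneous_add homogeneous_minus)

lemma homogeneous_sum: "(\<And>i. i \<in> A \<Longrightarrow> homogeneous n (f i)) \<Longrightarrow> homogeneous n (\<Sum>i\<in>A. f i)"
  by (induction A rule: infinite_finite_induct) (simp_all add: homogeneous_add)

definition form_degree1 :: "generator \<Rightarrow> nat" where
  "form_degree1 g = (if g \<in> {Gea, Geb, Gec, Ged} then 1 else 0)"

lemma form_degree_Word:
  "form_degree (Word []) = 0"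
  "form_degree (Word (g # gs)) = form_degree1 g + form_degree (Word gs)"
  by (simp_all add: form_degree_def form_degree1_def)

lemma homogeneous_gen: "homogeneous (form_degree1 g) (gen g)"
  by (simp add: gen_def homogeneous_def form_degree_Word)

lemma single_Cons: "Poly_Mapping.single (Word (g # gs)) (1::complex) = gen g * Poly_Mapping.single (Word gs) 1"
  by (simp add: gen_def mult_single plus_word_def)

text \<open>Four one-forms are adjoined to a filtration that is trivial above degree zero, so the
  result is trivial above degree four. Each generator raises \<open>F4\<close> by its own form
  degree, which puts every word of form degree five into \<open>F4 5\<close>.\<close>

lemma degree_five_in_Omega_ideal:
  assumes "q \<noteq> 0" "homogeneous 5 x"
  shows "x \<in> Omega_ideal q r"
proof -
  let ?J = "Omega_ideal q r"
  \<comment> \<open>Only vanishing in high degrees is at stake, so degree zero may be the whole free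
    algebra; then every element raises \<open>F0\<close> by 0.\<close>
  define F0 where "F0 n = (if n = 0 then UNIV else ?J)" for n :: nat
  define F1 where "F1 = filt_step ed F0"
  define F2 where "F2 = filt_step eb F1"
  define F3 where "F3 = filt_step ec F2"
  define F4 where "F4 = filt_step ea F3"
  interpret F0: filtration ?J F0
    by unfold_locales (auto simp: F0_def Omega_ideal_zero Omega_ideal_mult Omega_ideal_add)
  interpret F1: filtration ?J F1
    unfolding F1_def by (rule F0.filtration_filt_step)
  interpret F2: filtration ?J F2
    unfolding F2_def by (rule F1.filtration_filt_step)
  interpret F3: filtration ?J F3
    unfolding F3_def by (rule F2.filtration_filt_step)
  interpret F4: filtration ?J F4
    unfolding F4_def by (rule F3.filtration_filt_step)
  have scalar: "scalar c * e - (e * scalar c + 0) \<in> ?J" for c and e :: "generator free_algebra"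
    by (simp add: scalar_central Omega_ideal_zero)
  have F0: "raises F0 0 z" for z
    by (auto simp: raises_def F0_def Omega_ideal_mult)
  have F1: "raises F1 0 (scalar c)" "raises F1 0 xa" "raises F1 0 xb" "raises F1 0 xc"
    "raises F1 0 xd" "raises F1 1 ed" for c
  proof -
    show "raises F1 0 (scalar c)"
      unfolding F1_def by (rule F0.raises_filt_step[OF scalar F0 F0 F0.raises_zero])
    have "raises F1 0 u" "raises F1 0 v" if uv: "(u, v) \<in> {(xa, xc), (xb, xd)}" for u v
    proof -
      have "u * ed - (ed * (scalar (inverse q) * u) + 0) \<in> ?J"
        using Omega_ideal_cross(3)[OF uv] by (simp add: mult.assoc)
      then show "raises F1 0 u"
        unfolding F1_def by (rule F0.raises_filt_step[OF _ F0 F0 F0.raises_zero])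
      have "v * ed - (ed * (scalar q * v) + 0) \<in> ?J"
        using Omega_ideal_cross(4)[OF uv] by (simp add: mult.assoc)
      then show "raises F1 0 v"
        unfolding F1_def by (rule F0.raises_filt_step[OF _ F0 F0 F0.raises_zero])
    qed
    then show "raises F1 0 xa" "raises F1 0 xb" "raises F1 0 xc" "raises F1 0 xd"
      by blast+
    show "raises F1 1 ed"
      unfolding F1_def One_nat_def
      by (rule F0.raises_filt_step_self[where t = 0]) (simp_all add: Omega_ideal_form F0.raises_zero)
  qed
  have F2: "raises F2 0 (scalar c)" "raises F2 0 xa" "raises F2 0 xb" "raises F2 0 xc"
    "raises F2 0 xd" "raises F2 1 ed" "raises F2 1 eb" for c
  proof -
    note raises = F1 F1.raises_zero F1.raises_add F1.raises_mult
    note step = F1.raises_filt_step[where e = eb, folded F2_def]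
    show "raises F2 0 (scalar c)"
      by (rule step[OF scalar F1(1) F1(1) F1.raises_zero])
    have "raises F2 0 u \<and> raises F2 0 v" if uv: "(u, v) \<in> {(xa, xc), (xb, xd)}" for u v
    proof
      have uv': "raises F1 0 u" "raises F1 0 v"
        using F1 uv by auto
      show "raises F2 0 u"
        by (rule step[OF Omega_ideal_cross(5)[OF uv]]) (rule raises uv' refl | simp)+
      show "raises F2 0 v"
        by (rule step[of v v 0]) (use uv' Omega_ideal_cross(1)[OF uv] in \<open>simp_all add: F1.raises_zero\<close>)
    qed
    then show "raises F2 0 xa" "raises F2 0 xb" "raises F2 0 xc" "raises F2 0 xd"
      by blast+
    have "ed * eb - (eb * (scalar (- 1) * ed) + 0) \<in> ?J"
      using Omega_ideal_form(5) by (simp add: add.commute)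
    then show "raises F2 1 ed"
      by (rule step) (rule raises refl | simp)+
    show "raises F2 1 eb"
      unfolding F2_def One_nat_def
      by (rule F1.raises_filt_step_self[where t = 0]) (simp_all add: Omega_ideal_form F1.raises_zero)
  qed
  have F3: "raises F3 0 (scalar c)" "raises F3 0 xa" "raises F3 0 xb" "raises F3 0 xc"
    "raises F3 0 xd" "raises F3 1 ed" "raises F3 1 eb" "raises F3 1 ec" for c
  proof -
    note raises = F2 F2.raises_zero F2.raises_add F2.raises_mult
    note step = F2.raises_filt_step[where e = ec, folded F3_def]
    show "raises F3 0 (scalar c)"
      by (rule step[OF scalar F2(1) F2(1) F2.raises_zero])
    have "raises F3 0 u \<and> raises F3 0 v" if uv: "(u, v) \<in> {(xa, xc), (xb, xd)}" for u v
    proof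
      have uv': "raises F2 0 u" "raises F2 0 v"
        using F2 uv by auto
      show "raises F3 0 v"
        by (rule step[OF Omega_ideal_cross(6)[OF uv]]) (rule raises uv' refl | simp)+
      show "raises F3 0 u"
        by (rule step[of u u 0]) (use uv' Omega_ideal_cross(2)[OF uv] in \<open>simp_all add: F2.raises_zero\<close>)
    qed
    then show "raises F3 0 xa" "raises F3 0 xb" "raises F3 0 xc" "raises F3 0 xd"
      by blast+
    have "ed * ec - (ec * (scalar (- 1) * ed) + 0) \<in> ?J"
      using Omega_ideal_form(6) by (simp add: add.commute)
    then show "raises F3 1 ed"
      by (rule step) (rule raises refl | simp)+
    have "eb * ec - (ec * (scalar (- 1) * eb) + 0) \<in> ?J"
      using Omega_ideal_form(4) by (simp add: add.commute)
    then show "raises F3 1 eb"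
      by (rule step) (rule raises refl | simp)+
    show "raises F3 1 ec"
      unfolding F3_def One_nat_def
      by (rule F2.raises_filt_step_self[where t = 0]) (simp_all add: Omega_ideal_form F2.raises_zero)
  qed
  note raises = F3 F3.raises_zero F3.raises_add F3.raises_mult
  have F4: "raises F4 0 xa" "raises F4 0 xb" "raises F4 0 xc" "raises F4 0 xd"
    "raises F4 1 ed" "raises F4 1 eb" "raises F4 1 ec" "raises F4 1 ea" "raises F4 0 (scalar c)" for c
  proof -
    note step = F3.raises_filt_step[where e = ea, folded F4_def]
    show "raises F4 0 (scalar c)"
      by (rule step[OF scalar F3(1) F3(1) F3.raises_zero])
    have "raises F4 0 u \<and> raises F4 0 v" if uv: "(u, v) \<in> {(xa, xc), (xb, xd)}" for u v
    proof
      have uv': "raises F3 0 u" "raises F3 0 v"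
        using F3 uv by auto
      have "u * ea - (ea * (scalar q * u) + (scalar (mu q) * ec * v + scalar (q * (mu q)\<^sup>2) * ed * u)) \<in> ?J"
        using Omega_ideal_cross(8)[OF uv] by (simp add: mult.assoc add.assoc)
      then show "raises F4 0 u"
        by (rule step) (rule raises uv' refl | simp)+
      have "v * ea - (ea * (scalar (inverse q) * v) + scalar (mu q) * eb * u) \<in> ?J"
        using Omega_ideal_cross(7)[OF uv] by (simp add: mult.assoc)
      then show "raises F4 0 v"
        by (rule step) (rule raises uv' refl | simp)+
    qed
    then show "raises F4 0 xa" "raises F4 0 xb" "raises F4 0 xc" "raises F4 0 xd"
      by blast+
    have "ed * ea - (ea * (scalar (- 1) * ed) + scalar (- mu q) * eb * ec) \<in> ?J"
      using Omega_ideal_form(8) by (simp add: algebra_simps)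
    then show "raises F4 1 ed"
      by (rule step) (rule raises refl | simp)+
    \<comment> \<open>The relation is divided by \<open>q\<^sup>2\<close> in order to solve it for
      \<open>eb * ea\<close>.\<close>
    have "scalar (1 / q\<^sup>2) * (ea * eb + scalar (q\<^sup>2) * eb * ea - scalar (mu q) * eb * ed) \<in> ?J"
      using Omega_ideal_form(9) by (rule Omega_ideal_mult)
    then have "eb * ea - (ea * (scalar (- (1 / q\<^sup>2)) * eb) + scalar (mu q / q\<^sup>2) * eb * ed) \<in> ?J"
      using \<open>q \<noteq> 0\<close> by (simp add: algebra_simps scalar_mult_scalar)
    then show "raises F4 1 eb"
      by (rule step) (rule raises refl | simp)+
    have "ec * ea - (ea * (scalar (- q\<^sup>2) * ec) + scalar (- mu q) * ec * ed) \<in> ?J"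
      using Omega_ideal_form(10) by (simp add: algebra_simps)
    then show "raises F4 1 ec"
      by (rule step) (rule raises refl | simp)+
    show "raises F4 1 ea"
      unfolding F4_def One_nat_def
      by (rule F3.raises_filt_step_self[OF Omega_ideal_form(7)]) (rule raises refl | simp)+
  qed
  have "raises F4 (form_degree1 g) (gen g)" for g
    using F4 by (cases g) (simp_all add: form_degree1_def)
  then have "Poly_Mapping.single (Word gs) 1 \<in> F4 (form_degree (Word gs))" for gs
  proof (induction gs)
    case Nil
    show ?case
      by (simp add: F4_def F3_def F2_def F1_def F0_def filt_step_def form_degree_Word)
  next
    case (Cons g gs)
    then show ?case
      unfolding single_Cons form_degree_Word raises_def by (metis add.commute)
  qed
  then have single: "Poly_Mapping.single w 1 \<in> F4 5" if "form_degree w = 5" for w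
    using that by (cases w) metis
  from assms(2) have "x \<in> F4 5"
  proof (induction rule: homogeneous_induct)
    case zero
    show ?case using Omega_ideal_zero F4.subset by blast
  next
    case (add x y z)
    then show ?case
      using F4(9)[of z] unfolding raises_def by (metis F4.add add.right_neutral)
  qed (rule single)
  \<comment> \<open>The top degree modulo the ideal goes from 0 for \<open>F0\<close> to 4 for
    \<open>F4\<close>, one step per adjoined generator.\<close>
  moreover have "F4 5 \<subseteq> ?J"
    unfolding F4_def
  proof (rule filt_step_eq_ideal[OF F3.filtration_axioms])
    show "F3 n \<subseteq> ?J" if "n > 3" for n
      unfolding F3_def
    proof (rule filt_step_eq_ideal[OF F2.filtration_axioms])
      show "F2 n \<subseteq> ?J" if "n > 2" for n
        unfolding F2_def
      proof (rule filt_step_eq_ideal[OF F1.filtration_axioms])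
        show "F1 n \<subseteq> ?J" if "n > 1" for n
          unfolding F1_def
          by (rule filt_step_eq_ideal[OF F0.filtration_axioms])
            (use that in \<open>auto simp: F0_def intro: Omega_ideal_mult Omega_ideal_add\<close>)
      qed (use that in \<open>auto intro: Omega_ideal_mult Omega_ideal_add\<close>)
    qed (use that in \<open>auto intro: Omega_ideal_mult Omega_ideal_add\<close>)
  qed (auto intro: Omega_ideal_mult Omega_ideal_add)
  ultimately show ?thesis by blast
qed

section \<open>The contraction homotopy\<close>

definition th :: "generator free_algebra" where
  "th = ea + ed"

text \<open>This lifts the exterior derivative to the free algebra. Writing the sign as
  \<open>twist 1 (- 1)\<close> yields one linear map for all degrees at once.\<close>

definition ext_diff :: "generator free_algebra \<Rightarrow> generator free_algebra" where
  "ext_diff x = twist 1 (- 1) x * th - th * x"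

lemma homogeneous_th: "homogeneous 1 th"
  unfolding th_def
  using homogeneous_gen[of Gea] homogeneous_gen[of Ged]
  by (intro homogeneous_add) (simp_all add: form_degree1_def)

lemma homogeneous_rescale: "homogeneous n x \<Longrightarrow> homogeneous n (rescale \<chi> x)"
proof (induction rule: homogeneous_induct)
  case (single w)
  then have "homogeneous n (Poly_Mapping.single w 1)"
    by (simp add: homogeneous_def)
  then show ?case
    by (simp add: homogeneous_scalar_mult)
qed (simp_all add: homogeneous_add homogeneous_scalar_mult)

lemma homogeneous_ext_diff: "homogeneous n x \<Longrightarrow> homogeneous (Suc n) (ext_diff x)"
  using homogeneous_mult[OF homogeneous_rescale homogeneous_th, where m = n]
    homogeneous_mult[OF homogeneous_th, where n = n] homogeneous_add homogeneous_minus
  unfolding ext_diff_def diff_conv_add_uminus by (metis One_nat_def add.commute plus_1_eq_Suc)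

lemma sign_homogeneous: "homogeneous n x \<Longrightarrow> twist 1 (- 1) x = scalar ((- 1) ^ n) * x"
proof (induction rule: homogeneous_induct)
  case (single w)
  have "prod_list (map (weight 1 (- 1)) gs) = (- 1) ^ form_degree (Word gs)" for gs
  proof (induction gs)
    case (Cons g gs)
    then show ?case
      by (cases g) (simp_all add: form_degree_Word form_degree1_def)
  qed (simp add: form_degree_Word)
  from this[of "letters w"] single show ?case by simp
next
  case (add x y z)
  then show ?case
    by (simp add: distrib_left scalar_left_commute[of "scalar _"])
qed simp

text \<open>Degree zero is kept apart from the truncated \<open>n - 1\<close>: words in it contain
  no \<open>ea\<close>, so the contraction vanishes. This vanishing later gives exactness at the
  left end.\<close>

lemma contr_homogeneous:
  assumes "homogeneous n x"
  shows "if n = 0 then contr q x = 0 else homogeneous (n - 1) (contr q x)"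
  using assms
proof (induction rule: homogeneous_induct)
  case (single w)
  have "if form_degree (Word gs) = 0 then skew_deriv_list (weight q (- 1)) Gea gs = 0
    else homogeneous (form_degree (Word gs) - 1) (skew_deriv_list (weight q (- 1)) Gea gs)" for gs
  proof (induction gs)
    case (Cons g gs)
    let ?D = "skew_deriv_list (weight q (- 1)) Gea"
    \<comment> \<open>The truncation is harmless when \<open>gs\<close> has degree zero, since
      \<open>?D gs\<close> is then 0 and homogeneous of every degree.\<close>
    have D: "homogeneous (form_degree1 g + (form_degree (Word gs) - 1)) (gen g * ?D gs)"
      using Cons.IH homogeneous_mult[OF homogeneous_gen, of "form_degree (Word gs) - 1" "?D gs" g]
      by (simp split: if_splits)
    have D0: "?D gs = 0" if "form_degree (Word gs) = 0"
      using Cons.IH that by simp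
    show ?case
    proof (cases "form_degree1 g = 0")
      case True
      then have "g \<noteq> Gea" by (auto simp: form_degree1_def)
      with True D D0 show ?thesis
        by (auto simp: form_degree_Word mult.assoc intro: homogeneous_scalar_mult)
    next
      case False
      then have g: "form_degree1 g = 1" by (simp add: form_degree1_def split: if_splits)
      have "homogeneous (form_degree (Word gs)) (gen g * ?D gs)"
        using D D0 g by (cases "form_degree (Word gs) = 0") auto
      moreover have "homogeneous (form_degree (Word gs)) (Poly_Mapping.single (Word gs) 1)"
        by (simp add: homogeneous_def)
      ultimately show ?thesis
        using g by (auto simp: form_degree_Word mult.assoc
            intro!: homogeneous_scalar_mult homogeneous_add homogeneous_diff)
    qed
  qed (simp add: form_degree_Word)
  from this[of "letters w"] single show ?case by (cases w) (simp split: if_splits)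
qed (auto simp: homogeneous_add homogeneous_scalar_mult)

text \<open>Each term of the derivative has lost exactly one letter \<open>g\<close>; the factor
  \<open>\<psi> g\<close> accounts for it.\<close>

lemma skew_deriv_rescale:
  "skew_deriv \<chi> g (rescale \<psi> x) = scalar (\<psi> g) * rescale \<psi> (skew_deriv \<chi> g x)"
proof (induction x rule: free_algebra_induct)
  case (single w)
  have "scalar (prod_list (map \<psi> gs)) * skew_deriv_list \<chi> g gs
      = scalar (\<psi> g) * rescale \<psi> (skew_deriv_list \<chi> g gs)" for gs
  proof (induction gs)
    case (Cons h gs)
    have "scalar (\<psi> h * prod_list (map \<psi> gs)) * (scalar (\<chi> h) * (gen h * skew_deriv_list \<chi> g gs))
      = scalar (\<psi> h * \<chi> h) * (gen h * (scalar (prod_list (map \<psi> gs)) * skew_deriv_list \<chi> g gs))"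
      by (simp add: scalar_mult_scalar mult_ac)
    also have "\<dots> = scalar (\<psi> g) * rescale \<psi> (scalar (\<chi> h) * (gen h * skew_deriv_list \<chi> g gs))"
      unfolding Cons.IH by (simp add: scalar_mult_scalar mult_ac mult.assoc[of "scalar _"])
    finally show ?case
      by (simp add: distrib_left mult.assoc scalar_mult_scalar)
  qed simp
  from this[of "letters w"] show ?case by simp
next
  case (add x y z)
  have "scalar z * (scalar (\<psi> g) * u) = scalar (\<psi> g) * (scalar z * u)" for u
    by (simp add: scalar_mult_scalar mult.commute)
  with add show ?case by (simp add: distrib_left)
qed

lemma twist_twist: "twist t s (twist t' s' x) = twist (t * t') (s * s') x"
proof -
  have "(\<lambda>g. weight t s g * weight t' s' g) = weight (t * t') (s * s')"
  proof
    show "weight t s g * weight t' s' g = weight (t * t') (s * s') g" for g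
      by (cases g) (simp_all add: power_mult_distrib)
  qed
  then show ?thesis by (simp add: rescale_rescale)
qed

lemma twist_one [simp]: "twist 1 1 x = x"
proof -
  have "weight 1 1 = (\<lambda>_. 1)"
  proof
    show "weight 1 1 g = 1" for g by (cases g) simp_all
  qed
  then show ?thesis by simp
qed

lemma twist_th: "twist t s th = scalar s * th"
  by (simp add: th_def distrib_left)

lemma contr_th: "contr q th = 1"
  by (simp add: th_def)

lemma contr_th_mult: "contr q (th * x) = x - th * contr q x"
  by (simp add: skew_deriv_mult contr_th twist_th)

lemma contr_sign: "contr q (twist 1 (- 1) x) = - twist 1 (- 1) (contr q x)"
  by (simp add: skew_deriv_rescale)

text \<open>This is a Cartan formula. Contracting \<open>th\<close> in the two terms of
  \<open>ext_diff\<close> leaves \<sigma> applied to the sign twist of \<open>x\<close>, which is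
  \<Sigma>(x), and \<open>- x\<close>; the remaining terms reassemble to minus the derivative of the
  contraction.\<close>

lemma contr_ext_diff: "contr q (ext_diff x) = twist q 1 x - x - ext_diff (contr q x)"
  by (simp add: ext_diff_def skew_deriv_mult contr_th twist_th contr_sign twist_twist algebra_simps)

lemma ext_diff_linear [simp]:
  "ext_diff (x + y) = ext_diff x + ext_diff y" "ext_diff 0 = 0"
  "ext_diff (- x) = - ext_diff x" "ext_diff (x - y) = ext_diff x - ext_diff y"
  "ext_diff (scalar z * x) = scalar z * ext_diff x"
  by (simp_all add: ext_diff_def algebra_simps scalar_left_commute[of th])

lemma ext_diff_sum: "ext_diff (\<Sum>i\<in>A. f i) = (\<Sum>i\<in>A. ext_diff (f i))"
  by (induction A rule: infinite_finite_induct) simp_all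

lemma twist_ext_diff: "twist t 1 (ext_diff x) = ext_diff (twist t 1 x)"
  by (simp add: ext_diff_def twist_th twist_twist)

text \<open>The \<open>mu\<close> terms of \<open>ea * ea\<close> and of
  \<open>ea * ed + ed * ea\<close> cancel.\<close>

lemma th_square: "th * th \<in> Omega_ideal q r"
proof -
  have "th * th = (ea * ea - scalar (mu q) * eb * ec)
      + (ea * ed + ed * ea + scalar (mu q) * eb * ec) + ed * ed"
    by (simp add: th_def algebra_simps)
  then show ?thesis
    using Omega_ideal_form Omega_ideal_add by metis
qed

text \<open>Applying a graded commutator with \<open>th\<close> twice gives the commutator with
  \<open>th * th\<close>, which lies in the ideal.\<close>

lemma ext_diff_ext_diff: "ext_diff (ext_diff x) \<in> Omega_ideal q r"
proof -
  have "ext_diff (ext_diff x) = th * th * x - x * (th * th)"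
    by (simp add: ext_diff_def twist_th twist_twist algebra_simps)
  then show ?thesis
    using th_square Omega_ideal_mult Omega_ideal_diff by metis
qed

lemma ext_diff_th_mult: "ext_diff (th * x) + th * ext_diff x \<in> Omega_ideal q r"
proof -
  have "ext_diff (th * x) + th * ext_diff x = - (th * th * (x + x))"
    by (simp add: ext_diff_def twist_th algebra_simps)
  then show ?thesis
    using th_square Omega_ideal_mult Omega_ideal_minus by metis
qed

text \<open>The core of exactness: a closed \<open>x\<close> with \<open>th * x\<close> exact is
  \<open>th\<close> times a closed form plus an exact form. Both are expressed through contractions
  of elements of degree \<open>n\<close>, so that \<open>n = 0\<close> needs no separate
  statement.\<close>

lemma theta_exact:
  assumes q: "q \<noteq> 0" "q ^ r = 1" and "r > 0" and xy: "homogeneous n x" "homogeneous n y"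
    and dx: "ext_diff x \<in> Omega_ideal q r" and tx: "th * x - ext_diff y \<in> Omega_ideal q r"
  obtains \<alpha> \<beta> where "homogeneous n \<alpha>" "homogeneous n \<beta>" "ext_diff (contr q \<alpha>) \<in> Omega_ideal q r"
    "x - (th * contr q \<alpha> + ext_diff (contr q \<beta>)) \<in> Omega_ideal q r"
proof -
  let ?J = "Omega_ideal q r"
  \<comment> \<open>\<open>U k\<close> is the geometric sum of the first \<open>k\<close> powers of
    \<Sigma>, so \<Sigma> - 1 composed with \<open>U k\<close> is \<open>\<Sigma>^k - 1\<close>. In
    particular \<open>P = U r\<close> is \<open>r\<close> times the projection onto
    invariants.\<close>
  define U where "U k z = (\<Sum>j<k. twist (q ^ j) 1 z)" for k z
  define V where "V = (\<Sum>k<r. U k x)"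
  define P where "P = U r"
  have qk: "q ^ k \<noteq> 0" "(q ^ k) ^ r = 1" for k
    using q by (simp_all flip: power_mult add: mult.commute[of k] power_mult)
  have U_J: "U k z \<in> ?J" if "z \<in> ?J" for k z
    unfolding U_def using twist_Omega_ideal[OF qk that] by (intro Omega_ideal_sum)
  have U_diff: "ext_diff (U k z) = U k (ext_diff z)" for k z
    by (simp add: U_def ext_diff_sum twist_ext_diff)
  have U_th: "U k (th * z) = th * U k z" for k z
    by (simp add: U_def twist_th sum_distrib_left)
  have U_linear: "U k (z - w) = U k z - U k w" for k z w
    by (simp add: U_def sum_subtractf)
  have U_homogeneous: "homogeneous n (U k z)" if "homogeneous n z" for k z
    unfolding U_def using that by (intro homogeneous_sum homogeneous_rescale)
  have telescope: "twist q 1 (U k z) - U k z = twist (q ^ k) 1 z - z" for k z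
  proof -
    have "twist q 1 (U k z) = (\<Sum>j<k. twist (q ^ Suc j) 1 z)"
      by (simp add: U_def twist_twist)
    then show ?thesis
      unfolding U_def by (simp add: sum_lessThan_telescope[of "\<lambda>j. twist (q ^ j) 1 z" k, simplified] flip: sum_subtractf)
  qed
  \<comment> \<open>For \<open>k = r\<close> the telescoping sum vanishes, as
    \<open>q ^ r = 1\<close>.\<close>
  have P_fixed: "twist q 1 (P z) = P z" for z
    using telescope[of r z] q by (simp add: P_def)
  \<comment> \<open>The Cartan formula is applied to \<open>U k x\<close>, which is closed modulo
    the ideal. Summing over \<open>k\<close> then shows that \<open>P x\<close> and \<open>r\<close>
    times \<open>x\<close> are cohomologous, with primitive the contraction of
    \<open>V\<close>.\<close>
  have "twist (q ^ k) 1 x - x - ext_diff (contr q (U k x)) \<in> ?J" for k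
    using contr_Omega_ideal[OF q U_J[OF dx]] telescope[of k x] contr_ext_diff[of q "U k x"]
    by (metis U_diff)
  then have "(\<Sum>k<r. twist (q ^ k) 1 x - x - ext_diff (contr q (U k x))) \<in> ?J"
    by (intro Omega_ideal_sum)
  moreover have "(\<Sum>k<r. twist (q ^ k) 1 x - x - ext_diff (contr q (U k x)))
      = P x - of_nat r * x - ext_diff (contr q V)"
    by (simp add: sum_subtractf P_def U_def V_def ext_diff_sum)
  ultimately have J1: "P x - of_nat r * x - ext_diff (contr q V) \<in> ?J"
    by simp
  \<comment> \<open>The hypothesis on \<open>th * x\<close> is averaged and then contracted. As
    \<open>P y\<close> is invariant, the Cartan formula has no \<Sigma> - 1 term, and the homotopy
    identity for \<open>th\<close> recovers \<open>P x\<close>.\<close>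
  have "contr q (P (th * x - ext_diff y)) \<in> ?J"
    unfolding P_def by (intro contr_Omega_ideal q U_J tx)
  moreover have "contr q (P (th * x - ext_diff y)) = P x - th * contr q (P x) + ext_diff (contr q (P y))"
    using P_fixed[of y] unfolding P_def U_linear U_th
    by (simp add: contr_th_mult contr_ext_diff flip: U_diff)
  ultimately have J2: "P x - th * contr q (P x) + ext_diff (contr q (P y)) \<in> ?J"
    by simp
  \<comment> \<open>On invariants contraction and derivative anticommute, so the contraction of the
    closed \<open>P x\<close> is closed.\<close>
  have "ext_diff (contr q (P x)) = - contr q (P (ext_diff x))"
    using P_fixed[of x] contr_ext_diff[of q "P x"] by (simp add: P_def U_diff)
  moreover have "contr q (P (ext_diff x)) \<in> ?J"
    unfolding P_def by (intro contr_Omega_ideal q U_J dx)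
  ultimately have J3: "ext_diff (contr q (P x)) \<in> ?J"
    by (simp add: Omega_ideal_minus)
  define c :: "generator free_algebra" where "c = scalar (1 / of_nat r)"
  have "of_nat r = (scalar (of_nat r) :: generator free_algebra)"
    by (simp add: scalar_def)
  then have c: "c * (of_nat r * x) = x"
    using \<open>r > 0\<close> by (simp add: c_def scalar_mult_scalar)
  \<comment> \<open>Subtracting \<open>J1\<close> from \<open>J2\<close> eliminates
    \<open>P x\<close> and leaves \<open>r\<close> times \<open>x\<close>; dividing by
    \<open>r\<close> gives \<open>\<alpha> = c * P x\<close> and
    \<open>\<beta> = - (c * (P y + V))\<close>.\<close>
  have "c * (P x - th * contr q (P x) + ext_diff (contr q (P y)) -
      (P x - of_nat r * x - ext_diff (contr q V))) \<in> ?J"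
    by (intro Omega_ideal_mult Omega_ideal_diff J1 J2)
  also have "c * (P x - th * contr q (P x) + ext_diff (contr q (P y)) -
      (P x - of_nat r * x - ext_diff (contr q V)))
      = c * (of_nat r * x) - th * (c * contr q (P x)) + c * (ext_diff (contr q (P y + V)))"
    by (simp add: algebra_simps c_def)
       (metis mult.assoc scalar_central)
  also have "\<dots> = x - (th * contr q (c * P x) + ext_diff (contr q (- (c * (P y + V)))))"
    unfolding c by (simp add: c_def)
  finally have J4: "x - (th * contr q (c * P x) + ext_diff (contr q (- (c * (P y + V))))) \<in> ?J" .
  have "homogeneous n V"
    unfolding V_def using xy by (intro homogeneous_sum U_homogeneous)
  then have "homogeneous n (- (c * (P y + V)))" "homogeneous n (c * P x)"
    unfolding c_def P_def using xy
    by (auto intro!: homogeneous_minus homogeneous_scalar_mult homogeneous_add U_homogeneous)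
  moreover have "ext_diff (contr q (c * P x)) \<in> ?J"
    unfolding c_def using J3 by (simp add: Omega_ideal_mult)
  ultimately show thesis
    using J4 that by blast
qed

section \<open>Maps between quotient groups\<close>

text \<open>Since \<open>T\<close> maps \<open>B\<close> into \<open>B'\<close>, the coset of
  \<open>T \<omega>\<close> is independent of the representative. The image is therefore a singleton
  and \<open>the_elem\<close> picks a genuine value.\<close>

lemma the_elem_image_rcoset:
  assumes "comm_group K" "comm_group K'" "subgroup B K" "subgroup B' K'"
    and T: "T \<in> hom K K'" "\<And>b. b \<in> B \<Longrightarrow> T b \<in> B'" and x: "x \<in> carrier K"
  shows "the_elem ((\<lambda>\<omega>. B' #>\<^bsub>K'\<^esub> T \<omega>) ` (B #>\<^bsub>K\<^esub> x)) = B' #>\<^bsub>K'\<^esub> T x"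
proof -
  interpret K: comm_group K by fact
  interpret K': comm_group K' by fact
  interpret B: subgroup B K by fact
  interpret B': subgroup B' K' by fact
  have "B' #>\<^bsub>K'\<^esub> T (b \<otimes>\<^bsub>K\<^esub> x) = B' #>\<^bsub>K'\<^esub> T x" if "b \<in> B" for b
  proof -
    have "T x \<in> carrier K'"
      using T(1) x by (auto simp: hom_def)
    then have "B' #>\<^bsub>K'\<^esub> (T b \<otimes>\<^bsub>K'\<^esub> T x) = B' #>\<^bsub>K'\<^esub> T x"
      using T(2)[OF that] by (simp flip: K'.coset_mult_assoc add: B'.rcos_const[OF K'.is_group] B'.subset)
    then show ?thesis
      using T(1) that x by (simp add: hom_mult)
  qed
  then have "B' #>\<^bsub>K'\<^esub> T \<omega> = B' #>\<^bsub>K'\<^esub> T x" if "\<omega> \<in> B #>\<^bsub>K\<^esub> x" for \<omega>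
    using that unfolding r_coset_def[of K] by blast
  then have "(\<lambda>\<omega>. B' #>\<^bsub>K'\<^esub> T \<omega>) ` (B #>\<^bsub>K\<^esub> x) = (\<lambda>_. B' #>\<^bsub>K'\<^esub> T x) ` (B #>\<^bsub>K\<^esub> x)"
    by (rule image_cong[OF refl])
  also have "\<dots> = {B' #>\<^bsub>K'\<^esub> T x}"
    by (rule image_constant[OF K.rcos_self[OF x B.subgroup_axioms]])
  finally show ?thesis by simp
qed

lemma the_elem_hom_Mod:
  assumes "comm_group K" "comm_group K'" "subgroup B K" "subgroup B' K'"
    and T: "T \<in> hom K K'" "\<And>b. b \<in> B \<Longrightarrow> T b \<in> B'"
  shows "(\<lambda>C. the_elem ((\<lambda>\<omega>. B' #>\<^bsub>K'\<^esub> T \<omega>) ` C)) \<in> hom (K Mod B) (K' Mod B')"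
proof -
  interpret K: comm_group K by fact
  interpret K': comm_group K' by fact
  have B: "B \<lhd> K" "B' \<lhd> K'"
    using assms by (simp_all add: K.normal_iff_subgroup K'.normal_iff_subgroup)
  note map = the_elem_image_rcoset[OF assms]
  show ?thesis
  proof (rule homI)
    show "the_elem ((\<lambda>\<omega>. B' #>\<^bsub>K'\<^esub> T \<omega>) ` C) \<in> carrier (K' Mod B')"
      if "C \<in> carrier (K Mod B)" for C
      using that T(1) by (auto simp: carrier_FactGroup map hom_def)
  next
    fix C D assume "C \<in> carrier (K Mod B)" "D \<in> carrier (K Mod B)"
    then obtain x y where xy: "x \<in> carrier K" "y \<in> carrier K" "C = B #>\<^bsub>K\<^esub> x" "D = B #>\<^bsub>K\<^esub> y"
      by (auto simp: carrier_FactGroup)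
    moreover from this have "T x \<in> carrier K'" "T y \<in> carrier K'"
      using T(1) by (auto simp: hom_def)
    ultimately show "the_elem ((\<lambda>\<omega>. B' #>\<^bsub>K'\<^esub> T \<omega>) ` (C \<otimes>\<^bsub>K Mod B\<^esub> D))
      = the_elem ((\<lambda>\<omega>. B' #>\<^bsub>K'\<^esub> T \<omega>) ` C) \<otimes>\<^bsub>K' Mod B'\<^esub> the_elem ((\<lambda>\<omega>. B' #>\<^bsub>K'\<^esub> T \<omega>) ` D)"
      using T(1) by (simp add: normal.rcos_sum[OF B(1)] normal.rcos_sum[OF B(2)] map hom_mult)
  qed
qed

lemma rcoset_eq_self_iff:
  assumes "group G" "subgroup H G" "x \<in> carrier G"
  shows "H #>\<^bsub>G\<^esub> x = H \<longleftrightarrow> x \<in> H"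
  using assms by (metis group.coset_join1 group.coset_join2)

section \<open>The quotient algebra\<close>

context
  fixes q :: complex and r :: nat
begin

lemma Omega_ring: "ring (Omega q r)"
  unfolding Omega_def by (rule ideal.quotient_is_ring[OF Omega_ideal_is_ideal])

lemma Omega_class_hom: "Omega_class q r \<in> ring_hom ring_of_type_algebra (Omega q r)"
  using ideal.rcos_ring_hom[OF Omega_ideal_is_ideal[of q r]]
  unfolding Omega_def Omega_class_def[abs_def] .

lemma carrier_Omega: "carrier (Omega q r) = range (Omega_class q r)"
  by (auto simp: Omega_def Omega_class_def FactRing_def A_RCOSETS_def RCOSETS_def a_r_coset_def
      ring_of_type_algebra_def)

lemma Omega_class_closed [simp]: "Omega_class q r x \<in> carrier (Omega q r)"
  by (simp add: carrier_Omega)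

lemma Omega_class_simps [simp]:
  "Omega_class q r x \<oplus>\<^bsub>Omega q r\<^esub> Omega_class q r y = Omega_class q r (x + y)"
  "Omega_class q r x \<otimes>\<^bsub>Omega q r\<^esub> Omega_class q r y = Omega_class q r (x * y)"
  "\<one>\<^bsub>Omega q r\<^esub> = Omega_class q r 1"
  using ring_hom_add[OF Omega_class_hom, of x y] ring_hom_mult[OF Omega_class_hom, of x y]
    ring_hom_one[OF Omega_class_hom]
  by (simp_all add: ring_of_type_algebra_def)

text \<open>This transfers identities proved modulo the ideal for representatives to the quotient
  algebra.\<close>

lemma Omega_class_eq_iff: "Omega_class q r x = Omega_class q r y \<longleftrightarrow> x - y \<in> Omega_ideal q r"
proof -
  have "Omega_class q r z = (\<lambda>j. j + z) ` Omega_ideal q r" for z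
    by (auto simp: Omega_class_def a_r_coset_def r_coset_def ring_of_type_algebra_def)
  moreover have "(\<lambda>j. j + x) ` Omega_ideal q r = (\<lambda>j. j + y) ` Omega_ideal q r \<longleftrightarrow>
    x - y \<in> Omega_ideal q r"
  proof
    assume "(\<lambda>j. j + x) ` Omega_ideal q r = (\<lambda>j. j + y) ` Omega_ideal q r"
    moreover have "x \<in> (\<lambda>j. j + x) ` Omega_ideal q r"
      using Omega_ideal_zero by (force intro!: image_eqI[of _ _ 0])
    ultimately show "x - y \<in> Omega_ideal q r" by auto
  next
    assume xy: "x - y \<in> Omega_ideal q r"
    have "j + x \<in> (\<lambda>j. j + y) ` Omega_ideal q r" "j + y \<in> (\<lambda>j. j + x) ` Omega_ideal q r"
      if "j \<in> Omega_ideal q r" for j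
      using Omega_ideal_add[OF that xy] Omega_ideal_diff[OF that xy]
      by (auto intro!: image_eqI[where f = "\<lambda>j. j + y" and x = "j + (x - y)"]
          image_eqI[where f = "\<lambda>j. j + x" and x = "j - (x - y)"])
    then show "(\<lambda>j. j + x) ` Omega_ideal q r = (\<lambda>j. j + y) ` Omega_ideal q r"
      by blast
  qed
  ultimately show ?thesis by simp
qed

lemma Omega_zero [simp]: "\<zero>\<^bsub>Omega q r\<^esub> = Omega_class q r 0"
proof -
  interpret ring "Omega q r" by (rule Omega_ring)
  \<comment> \<open>An element of an additive group that equals its own double is zero.\<close>
  have "Omega_class q r 0 \<oplus>\<^bsub>Omega q r\<^esub> Omega_class q r 0 = Omega_class q r 0"
    by simp
  then show ?thesis
    by (metis Omega_class_closed add.r_cancel_one')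
qed

lemma Omega_class_minus [simp]:
  "\<ominus>\<^bsub>Omega q r\<^esub> Omega_class q r x = Omega_class q r (- x)"
  "Omega_class q r x \<ominus>\<^bsub>Omega q r\<^esub> Omega_class q r y = Omega_class q r (x - y)"
proof -
  interpret ring "Omega q r" by (rule Omega_ring)
  show "\<ominus>\<^bsub>Omega q r\<^esub> Omega_class q r x = Omega_class q r (- x)" for x
    by (rule minus_equality) simp_all
  then show "Omega_class q r x \<ominus>\<^bsub>Omega q r\<^esub> Omega_class q r y = Omega_class q r (x - y)"
    by (simp add: a_minus_def)
qed

lemma Omega_class_power:
  "Omega_class q r x [^]\<^bsub>Omega q r\<^esub> (n::nat) = Omega_class q r (x ^ n)"
proof -
  interpret ring "Omega q r" by (rule Omega_ring)
  show ?thesis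
    by (induction n) (simp_all add: power_commutes)
qed

lemma forms_eq: "forms q r i = Omega_class q r ` {x. homogeneous i x}"
  by (simp add: forms_def homogeneous_def)

lemma theta_eq: "theta q r = Omega_class q r th"
  by (simp add: theta_def th_def)

text \<open>On a homogeneous representative \<open>twist 1 (- 1)\<close> is multiplication by
  \<open>(- 1) ^ i\<close>, the sign in \<open>ext_d\<close>.\<close>

lemma ext_d_class:
  assumes "homogeneous i x"
  shows "ext_d q r i (Omega_class q r x) = Omega_class q r (ext_diff x)"
proof -
  have "ext_d q r i (Omega_class q r x) = Omega_class q r (- (th * x - (- 1) ^ i * (x * th)))"
    by (simp add: ext_d_def theta_eq Omega_class_power)
  moreover have "(- 1) ^ i * (x * th) = twist 1 (- 1) x * th"
    unfolding sign_homogeneous[OF assms] scalar_power[symmetric] by (simp add: mult.assoc)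
  ultimately show ?thesis by (simp add: ext_diff_def)
qed

section \<open>Cocycles and coboundaries in terms of representatives\<close>

lemma carrier_cocycle_group:
  "carrier (cocycle_group q r i)
    = Omega_class q r ` {x. homogeneous i x \<and> ext_diff x \<in> Omega_ideal q r}"
proof -
  have "carrier (cocycle_group q r i) = Omega_class q r `
      {x. homogeneous i x \<and> ext_d q r i (Omega_class q r x) = \<zero>\<^bsub>Omega q r\<^esub>}"
    unfolding cocycle_group_def forms_eq partial_object.simps by blast
  also have "{x. homogeneous i x \<and> ext_d q r i (Omega_class q r x) = \<zero>\<^bsub>Omega q r\<^esub>}
      = {x. homogeneous i x \<and> ext_diff x \<in> Omega_ideal q r}"
    by (intro Collect_cong conj_cong refl) (simp add: ext_d_class Omega_class_eq_iff)
  finally show ?thesis .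
qed

lemma coboundaries_eq:
  "coboundaries q r 0 = {Omega_class q r 0}"
  "coboundaries q r (Suc j) = Omega_class q r ` ext_diff ` {x. homogeneous j x}"
  by (auto simp: coboundaries_def forms_eq ext_d_class image_image intro!: image_cong)

lemma cocycle_group_simps [simp]:
  "x \<otimes>\<^bsub>cocycle_group q r i\<^esub> y = x \<oplus>\<^bsub>Omega q r\<^esub> y"
  "\<one>\<^bsub>cocycle_group q r i\<^esub> = \<zero>\<^bsub>Omega q r\<^esub>"
  by (simp_all add: cocycle_group_def)

lemma comm_group_cocycle_group: "comm_group (cocycle_group q r i)"
proof (rule comm_groupI)
  interpret ring "Omega q r" by (rule Omega_ring)
  show "x \<otimes>\<^bsub>cocycle_group q r i\<^esub> y \<in> carrier (cocycle_group q r i)"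
    if "x \<in> carrier (cocycle_group q r i)" "y \<in> carrier (cocycle_group q r i)" for x y
    using that by (auto simp: carrier_cocycle_group intro!: imageI homogeneous_add Omega_ideal_add)
  show "\<exists>y\<in>carrier (cocycle_group q r i). y \<otimes>\<^bsub>cocycle_group q r i\<^esub> x = \<one>\<^bsub>cocycle_group q r i\<^esub>"
    if "x \<in> carrier (cocycle_group q r i)" for x
  proof -
    from that obtain z where z: "x = Omega_class q r z" "homogeneous i z" "ext_diff z \<in> Omega_ideal q r"
      by (auto simp: carrier_cocycle_group)
    then have "Omega_class q r (- z) \<in> carrier (cocycle_group q r i)"
      by (auto simp: carrier_cocycle_group intro!: imageI homogeneous_minus Omega_ideal_minus)
    with z show ?thesis by force
  qed
qed (auto simp: carrier_cocycle_group Omega_ideal_zero add_ac intro!: imageI)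

lemma inv_cocycle_group:
  assumes "homogeneous i x" "ext_diff x \<in> Omega_ideal q r"
  shows "inv\<^bsub>cocycle_group q r i\<^esub> (Omega_class q r x) = Omega_class q r (- x)"
proof -
  interpret comm_group "cocycle_group q r i" by (rule comm_group_cocycle_group)
  show ?thesis
    by (rule inv_equality)
      (use assms in \<open>auto simp: carrier_cocycle_group intro!: imageI homogeneous_minus Omega_ideal_minus\<close>)
qed

lemma subgroup_coboundaries: "subgroup (coboundaries q r i) (cocycle_group q r i)"
proof -
  interpret comm_group "cocycle_group q r i" by (rule comm_group_cocycle_group)
  show ?thesis
  proof (cases i)
    case 0
    show ?thesis
      using triv_subgroup unfolding 0 coboundaries_eq by (simp add: 0)
  next
    case (Suc j)
    show ?thesis
    proof
      show "coboundaries q r i \<subseteq> carrier (cocycle_group q r i)"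
        unfolding Suc coboundaries_eq carrier_cocycle_group
        using homogeneous_ext_diff ext_diff_ext_diff by blast
      show "x \<otimes>\<^bsub>cocycle_group q r i\<^esub> y \<in> coboundaries q r i"
        if "x \<in> coboundaries q r i" "y \<in> coboundaries q r i" for x y
        using that unfolding Suc coboundaries_eq
        by (auto simp flip: ext_diff_linear intro!: imageI homogeneous_add)
      show "\<one>\<^bsub>cocycle_group q r i\<^esub> \<in> coboundaries q r i"
        unfolding Suc coboundaries_eq
        by (auto intro!: image_eqI[where x = 0])
      show "inv\<^bsub>cocycle_group q r i\<^esub> x \<in> coboundaries q r i" if "x \<in> coboundaries q r i" for x
      proof -
        from that obtain z where z: "x = Omega_class q r (ext_diff z)" "homogeneous j z"
          by (auto simp: Suc coboundaries_eq)
        then have "inv\<^bsub>cocycle_group q r i\<^esub> x = Omega_class q r (ext_diff (- z))"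
          using homogeneous_ext_diff[OF z(2)] ext_diff_ext_diff by (simp add: inv_cocycle_group Suc)
        with z(2) show ?thesis
          unfolding Suc coboundaries_eq using homogeneous_minus by blast
      qed
    qed
  qed
qed

lemma theta_mult_hom:
  "(\<lambda>\<omega>. theta q r \<otimes>\<^bsub>Omega q r\<^esub> \<omega>) \<in> hom (cocycle_group q r i) (cocycle_group q r (Suc i))"
proof (rule homI)
  fix x assume "x \<in> carrier (cocycle_group q r i)"
  then obtain z where z: "x = Omega_class q r z" "homogeneous i z" "ext_diff z \<in> Omega_ideal q r"
    by (auto simp: carrier_cocycle_group)
  have "ext_diff (th * z) + th * ext_diff z - th * ext_diff z \<in> Omega_ideal q r"
    by (intro Omega_ideal_diff ext_diff_th_mult Omega_ideal_mult z)
  then show "theta q r \<otimes>\<^bsub>Omega q r\<^esub> x \<in> carrier (cocycle_group q r (Suc i))"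
    using homogeneous_mult[OF homogeneous_th z(2)]
    by (auto simp: carrier_cocycle_group theta_eq z(1) intro!: imageI)
qed (auto simp: carrier_cocycle_group theta_eq distrib_left)

lemma theta_mult_coboundaries:
  assumes "b \<in> coboundaries q r i"
  shows "theta q r \<otimes>\<^bsub>Omega q r\<^esub> b \<in> coboundaries q r (Suc i)"
proof (cases i)
  case 0
  with assms show ?thesis
    by (auto simp: coboundaries_eq theta_eq intro!: image_eqI[where x = 0])
next
  case (Suc j)
  with assms obtain z where z: "b = Omega_class q r (ext_diff z)" "homogeneous j z"
    by (auto simp: coboundaries_eq)
  \<comment> \<open>As \<open>th\<close> is closed, \<open>- (th * z)\<close> is a primitive of
    \<open>th * ext_diff z\<close>.\<close>
  have "th * ext_diff z - ext_diff (- (th * z)) \<in> Omega_ideal q r"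
    using ext_diff_th_mult[of z q r] by (simp add: add.commute)
  then have "theta q r \<otimes>\<^bsub>Omega q r\<^esub> b = Omega_class q r (ext_diff (- (th * z)))"
    by (simp add: theta_eq z(1) Omega_class_eq_iff)
  moreover have "homogeneous i (- (th * z))"
    using homogeneous_mult[OF homogeneous_th z(2)] by (simp add: Suc homogeneous_minus)
  ultimately show ?thesis
    unfolding coboundaries_eq by blast
qed

section \<open>The induced maps on cohomology\<close>

lemmas theta_map_facts = comm_group_cocycle_group comm_group_cocycle_group
  subgroup_coboundaries subgroup_coboundaries theta_mult_hom theta_mult_coboundaries

lemma theta_map_rcoset:
  "x \<in> carrier (cocycle_group q r i) \<Longrightarrow>
    theta_map q r i (coboundaries q r i #>\<^bsub>cocycle_group q r i\<^esub> x)
      = coboundaries q r (Suc i) #>\<^bsub>cocycle_group q r (Suc i)\<^esub> (theta q r \<otimes>\<^bsub>Omega q r\<^esub> x)"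
  unfolding theta_map_def by (rule the_elem_image_rcoset[OF theta_map_facts])

lemma theta_map_hom: "theta_map q r i \<in> hom (cohomology q r i) (cohomology q r (Suc i))"
  using the_elem_hom_Mod[OF theta_map_facts, of i]
  unfolding cohomology_def theta_map_def[abs_def] by simp

lemma group_cohomology: "group (cohomology q r i)"
  unfolding cohomology_def
  by (intro comm_group.axioms(2) comm_group.abelian_FactGroup comm_group_cocycle_group
      subgroup_coboundaries)

lemma carrier_cohomology: "carrier (cohomology q r i)
  = (\<lambda>x. coboundaries q r i #>\<^bsub>cocycle_group q r i\<^esub> x) ` carrier (cocycle_group q r i)"
  by (simp add: cohomology_def carrier_FactGroup)

lemma one_cohomology [simp]: "\<one>\<^bsub>cohomology q r i\<^esub> = coboundaries q r i"
  by (simp add: cohomology_def)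

lemma cocycle_rcoset_eq_coboundaries_iff:
  "x \<in> carrier (cocycle_group q r i) \<Longrightarrow>
    coboundaries q r i #>\<^bsub>cocycle_group q r i\<^esub> x = coboundaries q r i \<longleftrightarrow> x \<in> coboundaries q r i"
  by (intro rcoset_eq_self_iff comm_group.axioms(2) comm_group_cocycle_group subgroup_coboundaries)

lemma theta_map_eq_one_iff:
  assumes "x \<in> carrier (cocycle_group q r i)"
  shows "theta_map q r i (coboundaries q r i #>\<^bsub>cocycle_group q r i\<^esub> x) = coboundaries q r (Suc i)
    \<longleftrightarrow> theta q r \<otimes>\<^bsub>Omega q r\<^esub> x \<in> coboundaries q r (Suc i)"
  using theta_mult_hom[of i] assms
  by (simp add: theta_map_rcoset cocycle_rcoset_eq_coboundaries_iff hom_def Pi_iff)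

section \<open>Exactness at each cohomology group\<close>

context
  assumes q: "q \<noteq> 0" "q ^ r = 1" and r: "r > 0"
begin

text \<open>In degree zero both contractions supplied by \<open>theta_exact\<close> vanish, so the
  representative itself lies in the ideal.\<close>

lemma theta_map_kernel_0:
  "kernel (cohomology q r 0) (cohomology q r 1) (theta_map q r 0) = {\<one>\<^bsub>cohomology q r 0\<^esub>}"
proof -
  have mem: "x \<in> coboundaries q r 0"
    if x: "x \<in> carrier (cocycle_group q r 0)"
      and tx: "theta q r \<otimes>\<^bsub>Omega q r\<^esub> x \<in> coboundaries q r (Suc 0)" for x
  proof -
    obtain z where z: "x = Omega_class q r z" "homogeneous 0 z" "ext_diff z \<in> Omega_ideal q r"
      using x by (auto simp: carrier_cocycle_group)
    obtain y where y: "homogeneous 0 y" "th * z - ext_diff y \<in> Omega_ideal q r"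
      using tx by (auto simp: z(1) theta_eq coboundaries_eq Omega_class_eq_iff)
    obtain \<alpha> \<beta> where "homogeneous 0 \<alpha>" "homogeneous 0 \<beta>"
      and ab: "z - (th * contr q \<alpha> + ext_diff (contr q \<beta>)) \<in> Omega_ideal q r"
      by (rule theta_exact[OF q r z(2) y(1) z(3) y(2)])
    then have "contr q \<alpha> = 0" "contr q \<beta> = 0"
      using contr_homogeneous[where n = 0 and q = q] by auto
    with ab show ?thesis
      by (simp add: z(1) coboundaries_eq Omega_class_eq_iff)
  qed
  have "coboundaries q r 0 \<in> carrier (cohomology q r 0)"
    using monoid.one_closed[OF group.is_monoid[OF group_cohomology], of 0] by simp
  moreover have "theta_map q r 0 (coboundaries q r 0) = coboundaries q r (Suc 0)"
    using hom_one[OF theta_map_hom group_cohomology group_cohomology, of 0] by simp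
  moreover have "C = coboundaries q r 0"
    if C: "C \<in> carrier (cohomology q r 0)" "theta_map q r 0 C = coboundaries q r (Suc 0)" for C
  proof -
    from C(1) obtain x where x: "x \<in> carrier (cocycle_group q r 0)"
      "C = coboundaries q r 0 #>\<^bsub>cocycle_group q r 0\<^esub> x"
      unfolding carrier_cohomology by blast
    with C(2) have "x \<in> coboundaries q r 0"
      using mem theta_map_eq_one_iff by simp
    with x show ?thesis
      by (simp add: cocycle_rcoset_eq_coboundaries_iff)
  qed
  ultimately show ?thesis
    unfolding kernel_def one_cohomology One_nat_def by blast
qed

text \<open>From right to left this is \<open>th * th = 0\<close> modulo the ideal; from left to
  right it is \<open>theta_exact\<close>, whose \<alpha> yields the preimage class and whose \<beta>
  the coboundary by which representatives differ.\<close>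

lemma theta_map_exact_at:
  assumes "x \<in> carrier (cocycle_group q r (Suc i))"
  shows "theta q r \<otimes>\<^bsub>Omega q r\<^esub> x \<in> coboundaries q r (Suc (Suc i)) \<longleftrightarrow>
    coboundaries q r (Suc i) #>\<^bsub>cocycle_group q r (Suc i)\<^esub> x
      \<in> theta_map q r i ` carrier (cohomology q r i)" (is "?L \<longleftrightarrow> ?R")
proof
  assume ?R
  then obtain y where y: "y \<in> carrier (cocycle_group q r i)"
    "coboundaries q r (Suc i) #>\<^bsub>cocycle_group q r (Suc i)\<^esub> x
      = coboundaries q r (Suc i) #>\<^bsub>cocycle_group q r (Suc i)\<^esub> (theta q r \<otimes>\<^bsub>Omega q r\<^esub> y)"
    by (auto simp: carrier_cohomology theta_map_rcoset)
  have ty: "theta q r \<otimes>\<^bsub>Omega q r\<^esub> y \<in> carrier (cocycle_group q r (Suc i))"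
    using theta_mult_hom[of i] y(1) by (auto simp: hom_def)
  obtain z where z: "y = Omega_class q r z" "homogeneous i z"
    using y(1) by (auto simp: carrier_cocycle_group)
  have "theta q r \<otimes>\<^bsub>Omega q r\<^esub> (theta q r \<otimes>\<^bsub>Omega q r\<^esub> y) = Omega_class q r 0"
    using Omega_ideal_mult(2)[OF th_square, of z]
    by (simp add: z(1) theta_eq Omega_class_eq_iff mult.assoc)
  also have "\<dots> \<in> coboundaries q r (Suc (Suc i))"
    by (auto simp: coboundaries_eq intro!: image_eqI[where x = 0])
  finally show ?L
    \<comment> \<open>The cocycle \<open>x\<close> and the product of \<open>theta\<close> with
      \<open>y\<close> have the same coset, so their products with \<open>theta\<close> are
      coboundaries simultaneously.\<close>
    using y(2) theta_map_eq_one_iff[OF assms] theta_map_eq_one_iff[OF ty] by simp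
next
  assume ?L
  obtain z where z: "x = Omega_class q r z" "homogeneous (Suc i) z" "ext_diff z \<in> Omega_ideal q r"
    using assms by (auto simp: carrier_cocycle_group)
  obtain y where y: "homogeneous (Suc i) y" "th * z - ext_diff y \<in> Omega_ideal q r"
    using \<open>?L\<close> by (auto simp: z(1) theta_eq coboundaries_eq Omega_class_eq_iff)
  obtain \<alpha> \<beta> where "homogeneous (Suc i) \<alpha>" "homogeneous (Suc i) \<beta>"
    and ab: "ext_diff (contr q \<alpha>) \<in> Omega_ideal q r"
      "z - (th * contr q \<alpha> + ext_diff (contr q \<beta>)) \<in> Omega_ideal q r"
    by (rule theta_exact[OF q r z(2) y(1) z(3) y(2)])
  then have h: "homogeneous i (contr q \<alpha>)" "homogeneous i (contr q \<beta>)"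
    using contr_homogeneous[where n = "Suc i" and q = q] by auto
  define w where "w = Omega_class q r (contr q \<alpha>)"
  define b where "b = Omega_class q r (ext_diff (contr q \<beta>))"
  have w: "w \<in> carrier (cocycle_group q r i)"
    using h ab(1) by (auto simp: w_def carrier_cocycle_group)
  have b: "b \<in> coboundaries q r (Suc i)"
    using h by (auto simp: b_def coboundaries_eq)
  interpret K: comm_group "cocycle_group q r (Suc i)" by (rule comm_group_cocycle_group)
  have tw: "theta q r \<otimes>\<^bsub>Omega q r\<^esub> w \<in> carrier (cocycle_group q r (Suc i))"
    using theta_mult_hom[of i] w by (auto simp: hom_def)
  have "x = b \<otimes>\<^bsub>cocycle_group q r (Suc i)\<^esub> (theta q r \<otimes>\<^bsub>Omega q r\<^esub> w)"
    using ab(2) by (simp add: z(1) b_def w_def theta_eq Omega_class_eq_iff add.commute)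
  then have "x \<in> coboundaries q r (Suc i) #>\<^bsub>cocycle_group q r (Suc i)\<^esub> (theta q r \<otimes>\<^bsub>Omega q r\<^esub> w)"
    using b by (auto simp: r_coset_def)
  then have "coboundaries q r (Suc i) #>\<^bsub>cocycle_group q r (Suc i)\<^esub> x
      = theta_map q r i (coboundaries q r i #>\<^bsub>cocycle_group q r i\<^esub> w)"
    unfolding theta_map_rcoset[OF w]
    by (metis K.repr_independence subgroup_coboundaries tw)
  then show ?R
    using w by (auto simp: carrier_cohomology)
qed

lemma theta_map_kernel:
  "kernel (cohomology q r (Suc i)) (cohomology q r (Suc (Suc i))) (theta_map q r (Suc i))
    = theta_map q r i ` carrier (cohomology q r i)"
proof -
  have "theta_map q r i ` carrier (cohomology q r i) \<subseteq> carrier (cohomology q r (Suc i))"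
    by (rule hom_carrier[OF theta_map_hom])
  moreover have "C \<in> theta_map q r i ` carrier (cohomology q r i) \<longleftrightarrow>
      theta_map q r (Suc i) C = \<one>\<^bsub>cohomology q r (Suc (Suc i))\<^esub>"
    if "C \<in> carrier (cohomology q r (Suc i))" for C
  proof -
    from that obtain x where "x \<in> carrier (cocycle_group q r (Suc i))"
      "C = coboundaries q r (Suc i) #>\<^bsub>cocycle_group q r (Suc i)\<^esub> x"
      unfolding carrier_cohomology by blast
    then show ?thesis
      using theta_map_exact_at theta_map_eq_one_iff by simp
  qed
  ultimately show ?thesis
    unfolding kernel_def by blast
qed

text \<open>The product of \<open>th\<close> with a 4-form has degree five and is therefore zero, so
  the criterion \<open>theta_map_exact_at\<close> applies to every class in degree four.\<close>

lemma theta_map_3_surjective: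
  "theta_map q r 3 ` carrier (cohomology q r 3) = carrier (cohomology q r 4)"
proof -
  have "theta q r \<otimes>\<^bsub>Omega q r\<^esub> x \<in> coboundaries q r 5" if x: "x \<in> carrier (cocycle_group q r 4)" for x
  proof -
    obtain z where z: "x = Omega_class q r z" "homogeneous 4 z"
      using x by (auto simp: carrier_cocycle_group)
    have "th * z \<in> Omega_ideal q r"
      using homogeneous_mult[OF homogeneous_th z(2)] by (intro degree_five_in_Omega_ideal q) simp
    then have "theta q r \<otimes>\<^bsub>Omega q r\<^esub> x = Omega_class q r (ext_diff 0)"
      by (simp add: z(1) theta_eq Omega_class_eq_iff)
    moreover have "coboundaries q r 5 = Omega_class q r ` ext_diff ` {x. homogeneous 4 x}"
      using coboundaries_eq(2)[of 4] by simp
    ultimately show ?thesis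
      using homogeneous_zero by blast
  qed
  then have "carrier (cohomology q r 4) \<subseteq> theta_map q r 3 ` carrier (cohomology q r 3)"
    using theta_map_exact_at[of _ 3] unfolding carrier_cohomology[of 4] by auto
  moreover have "theta_map q r 3 ` carrier (cohomology q r 3) \<subseteq> carrier (cohomology q r 4)"
    using hom_carrier[OF theta_map_hom[of 3]] by simp
  ultimately show ?thesis by blast
qed

end

end

text \<open>\<open>exact_seq\<close> lists groups and maps from the target end to the source end.
  All groups share one element type, so the trivial groups are realised with the single element
  \<open>{}\<close>. Injectivity at the left and surjectivity at the right are the kernel conditions
  next to them.\<close>

theorem proposition3p5:
  fixes q :: complex and r :: nat
  assumes "r \<in> {3, 5, 7}"
    and "primitive_root_of_unity r q"
  shows "exact_seq
    ([singleton_group {},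
      cohomology q r 4, cohomology q r 3, cohomology q r 2, cohomology q r 1, cohomology q r 0,
      singleton_group {}],
     [(\<lambda>_. {}),
      theta_map q r 3, theta_map q r 2, theta_map q r 1, theta_map q r 0,
      (\<lambda>_. \<one>\<^bsub>cohomology q r 0\<^esub>)])"
proof -
  from assms(2) have q: "q ^ r = 1" and r: "r > 0"
    by (simp_all add: primitive_root_of_unity_def)
  then have "q \<noteq> 0"
    by (metis power_0_left zero_neq_one neq0_conv)
  note facts = this q r
  note hom = theta_map_hom[of q r 0] theta_map_hom[of q r 1] theta_map_hom[of q r 2]
    theta_map_hom[of q r 3]
  note kernel = theta_map_kernel_0[OF facts] theta_map_kernel[OF facts, of 0]
    theta_map_kernel[OF facts, of 1] theta_map_kernel[OF facts, of 2]
  have trivial: "group_hom (singleton_group {}) (cohomology q r 0) (\<lambda>_. \<one>\<^bsub>cohomology q r 0\<^esub>)"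
    using monoid.one_closed[OF group.is_monoid[OF group_cohomology]]
      monoid.r_one[OF group.is_monoid[OF group_cohomology] monoid.one_closed[OF group.is_monoid[OF group_cohomology]]]
    by (simp add: group_hom_def group_hom_axioms_def group_cohomology hom_def del: one_cohomology)
  \<comment> \<open>The kernel of the map to the trivial group is all of degree four cohomology, so
    exactness there is surjectivity.\<close>
  have last: "kernel (cohomology q r 4) (singleton_group {}) (\<lambda>_. {})
      = theta_map q r 3 ` carrier (cohomology q r 3)"
    unfolding theta_map_3_surjective[OF facts] by (simp add: kernel_def singleton_group_def)
  show ?thesis
    using trivial hom kernel last
    by (simp add: group_cohomology group.hom_into_singleton_iff[OF group_cohomology] eval_nat_numeral)
qed

end
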